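(* Let $\theta=t\frac{d}{dt}$ and $\mathcal L_2(t,\theta)=\theta^2-t(10\theta^2+10\theta+3)+9t^2(\theta+1)^2$. Let $\phi(t)$ be the analytic at $t=0$ solution of $\mathcal L_2\phi=0$ with $\phi(t)=1+3t+O(t^2)$, and let $\psi(t)$ be the analytic at $t=0$ solution of $\mathcal L_2\psi=\frac{t}{1-t}$ with $\psi(t)=t+O(t^2)$. Then \[ m(P_3)=-\mathrm{Re}\,\Bigl(t\frac{d}{dt}\Bigr)^{-1}\Bigl[\frac34\phi(t)+\frac{6}{\pi^2}\psi(t)\Bigr]\Big|_{t=\infty}. \]
   Context: For a Laurent polynomial $P$ in $n$ variables, $m(P)=\frac{1}{(2\pi i)^n}\int_{|x_i|=1}\log|P|\,\frac{dx_1}{x_1}\cdots\frac{dx_n}{x_n}$ is its Mahler measure, and $P_3=(1+x_1+x_2+x_3)(1+x_1^{-1}+x_2^{-1}+x_3^{-1})$ (so $m(P_3)=2m(1+x_1+x_2+x_3)$). Convention: for a power series $b(t)=\sum_{m\ge0}b_mt^m$ convergent near $0$, $\bigl(t\frac{d}{dt}\bigr)^{-1}b(t)=b_0\log t+\sum_{m\ge1}\frac{b_m}{m}t^m$; this function is analytically continued along the negative real half-axis $-\infty<t<0$, and the expression $-\mathrm{Re}\,(\cdot)|_{t=\infty}$ denotes the limit of minus its real part as $t\to-\infty$ along this half-axis (the real part does not depend on the branch of $\log t$). *)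

theory Defs
  imports "HOL-Analysis.Analysis"
begin

definition mahler3 :: "(complex \<Rightarrow> complex \<Rightarrow> complex \<Rightarrow> complex) \<Rightarrow> real" where
  "mahler3 P = (LINT s : {0..1} \<times> {0..1} \<times> {0..1} | lborel.
      ln (cmod (P (cis (2 * pi * fst s)) (cis (2 * pi * fst (snd s))) (cis (2 * pi * snd (snd s))))))"

definition P3 :: "complex \<Rightarrow> complex \<Rightarrow> complex \<Rightarrow> complex" where
  "P3 x1 x2 x3 = (1 + x1 + x2 + x3) * (1 + inverse x1 + inverse x2 + inverse x3)"

definition theta :: "(complex \<Rightarrow> complex) \<Rightarrow> complex \<Rightarrow> complex" where
  "theta f = (\<lambda>t. t * deriv f t)"

definition L2 :: "(complex \<Rightarrow> complex) \<Rightarrow> complex \<Rightarrow> complex" where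
  "L2 f t = theta (theta f) t
            - t * (10 * theta (theta f) t + 10 * theta f t + 3 * f t)
            + 9 * t^2 * (theta (theta f) t + 2 * theta f t + f t)"

text \<open>The non-logarithmic part of (t d/dt)^{-1} b, i.e. sum_{m>=1} (b_m/m) t^m,
  where b_m = b^{(m)}(0)/m! are the Taylor coefficients of b at 0.\<close>
definition inv_theta_series :: "(complex \<Rightarrow> complex) \<Rightarrow> complex \<Rightarrow> complex" where
  "inv_theta_series b t =
     (\<Sum>m. (deriv ^^ Suc m) b 0 / (fact (Suc m) * of_nat (Suc m)) * t ^ Suc m)"

end

theory Submission
  imports Defs "HOL-Complex_Analysis.Complex_Analysis"
begin

text \<open>
  Let \<open>P = |1 + x + y|^2\<close> on the torus. Jensen's formula in the third variable turns
  \<open>m(P3)\<close> into the integral of \<open>log P\<close> over the region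
  \<open>P > 1\<close>. In half angles \<open>P - 1 = 8 cos p cos q cos (p - q)\<close>, so this
  region is a hexagon; its symmetries cut it into three copies of the square
  \<open>[0, pi/2]^2\<close>. The moments \<open>c_n\<close> of \<open>P\<close> over the region
  satisfy, by the divergence theorem on the square,
  \<open>(n+1)^2 c_(n+1) - (10n^2+10n+3) c_n + 9n^2 c_(n-1) = 6/pi^2\<close>, where the right-hand
  side comes from the flux through the boundary \<open>P = 1\<close>. This recurrence with
  \<open>c_0 = 3/4\<close> is also the one that the differential equations impose on the Taylor
  coefficients of \<open>3/4 phi + 6/pi^2 psi\<close>, so this function is the integral of
  \<open>1/(1 - tP)\<close> over the region. Its \<open>inverse theta\<close> is
  \<open>3/4 log t\<close> minus the integral of \<open>log (1 - tP)\<close>, which continues to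
  the plane slit along \<open>[1/9, \<infinity>)\<close>, and as \<open>t\<close> tends to
  \<open>-\<infinity>\<close> minus its real part tends to the integral of \<open>log P\<close>.
\<close>

subsection \<open>Moment recurrence\<close>

text \<open>\<open>walk_sq p q\<close> is \<open>|1 + x + y|^2\<close> at \<open>x = exp(2ip)\<close>, \<open>y = exp(2iq)\<close>; see \<open>cmod_eq_walk_sq\<close>.\<close>

definition walk_sq :: "real \<Rightarrow> real \<Rightarrow> real" where
  "walk_sq p q = 1 + 8 * cos p * cos q * cos (p - q)"

text \<open>
  The divergence identity behind the recurrence: for \<open>g(P) = P^m\<close>, the field
  \<open>g'(P) X + g(P) Y\<close> has divergence
  \<open>P(P-1)(P-9) g'' + (3P^2-20P+9) g' + (P-3) g\<close>. Here
  \<open>X = (fieldX p q, fieldX q p)\<close> and \<open>Y = (fieldY p q, fieldY q p)\<close>. The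
  coefficients solve the linear system that expresses
  \<open>grad P . X = P(P-1)(P-9)\<close>, \<open>div X + grad P . Y = 3P^2-20P+9\<close> and
  \<open>div Y = P-3\<close> and that the normal
  components vanish on the axes \<open>p = 0\<close>,
  \<open>q = 0\<close>, and for \<open>X\<close> also on \<open>p = pi/2\<close>,
  \<open>q = pi/2\<close>.
\<close>

definition fieldX :: "real \<Rightarrow> real \<Rightarrow> real" where
  "fieldX p q = 5 * sin (2*p)
     + 5/2 * (sin (2*q) + sin (2*p - 2*q) + sin (2*p + 2*q) + sin (4*p - 2*q))
     + sin (4*p) + sin (4*q) / 2 + sin (4*p - 4*q) / 2"

definition fieldY :: "real \<Rightarrow> real \<Rightarrow> real" where
  "fieldY p q = sin (2*p) + sin (2*q) / 2 + sin (2*p - 2*q) / 2"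

text \<open>The \<open>_deriv\<close> functions are partial derivatives in the first argument
  (\<open>field_derivs\<close>). P is symmetric and the second components of the fields arise by
  exchanging p and q, so the same functions with exchanged arguments give the derivatives in
  q.\<close>

definition walk_sq_deriv :: "real \<Rightarrow> real \<Rightarrow> real" where
  "walk_sq_deriv p q = - 4 * (sin (2*p) + sin (2*p - 2*q))"

definition fieldX_deriv :: "real \<Rightarrow> real \<Rightarrow> real" where
  "fieldX_deriv p q = 10 * cos (2*p) + 5 * (cos (2*p - 2*q) + cos (2*p + 2*q) + 2 * cos (4*p - 2*q))
     + 4 * cos (4*p) + 2 * cos (4*p - 4*q)"

definition fieldY_deriv :: "real \<Rightarrow> real \<Rightarrow> real" where
  "fieldY_deriv p q = 2 * cos (2*p) + cos (2*p - 2*q)"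

lemma walk_sq_alt: "walk_sq p q = 3 + 2 * cos (2*p) + 2 * cos (2*q) + 2 * cos (2*p - 2*q)"
proof -
  have e: "2*p-2*q = 2*(p-q)" by simp
  have 1: "(sin p)\<^sup>2 + (cos p)\<^sup>2 = 1" "(sin q)\<^sup>2 + (cos q)\<^sup>2 = 1" by auto
  show ?thesis unfolding walk_sq_def e cos_double cos_diff sin_diff using 1 by algebra
qed

text \<open>In the sines and cosines of 2p and 2q this is a polynomial identity modulo the two
  Pythagorean relations. The roots 0, 1, 9 are the critical values of P on the torus; under t = 1/P
  they match the singularities of \<open>L2\<close> at infinity, 1 and 1/9.\<close>

lemma grad_dot_fieldX:
  "walk_sq_deriv p q * fieldX p q + walk_sq_deriv q p * fieldX q p
    = walk_sq p q * (walk_sq p q - 1) * (walk_sq p q - 9)"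
proof -
  define a where "a = 2*p" define b where "b = 2*q"
  have e: "2*p = a" "2*q = b" "4*p = 2*a" "4*q = 2*b" by (auto simp: a_def b_def)
  have 1: "(sin a)\<^sup>2 + (cos a)\<^sup>2 = 1" "(sin b)\<^sup>2 + (cos b)\<^sup>2 = 1" by auto
  show ?thesis unfolding walk_sq_alt walk_sq_deriv_def fieldX_def e cos_double cos_diff sin_diff
    sin_add sin_double using 1 by algebra
qed

lemma div_fieldX:
  "fieldX_deriv p q + fieldX_deriv q p + walk_sq_deriv p q * fieldY p q
    + walk_sq_deriv q p * fieldY q p = 3 * walk_sq p q ^ 2 - 20 * walk_sq p q + 9"
proof -
  define a where "a = 2*p" define b where "b = 2*q"
  have e: "2*p = a" "2*q = b" "4*p = 2*a" "4*q = 2*b" by (auto simp: a_def b_def)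
  have 1: "(sin a)\<^sup>2 + (cos a)\<^sup>2 = 1" "(sin b)\<^sup>2 + (cos b)\<^sup>2 = 1" by auto
  show ?thesis unfolding walk_sq_alt walk_sq_deriv_def fieldX_deriv_def fieldY_def e cos_double
    cos_diff sin_diff sin_add sin_double cos_add using 1 by algebra
qed

lemma div_fieldY: "fieldY_deriv p q + fieldY_deriv q p = walk_sq p q - 3"
proof -
  have "cos (2*q-2*p) = cos (2*p-2*q)" by (metis cos_minus minus_diff_eq)
  thus ?thesis by (simp add: fieldY_deriv_def walk_sq_alt)
qed

lemma field_derivs: "((\<lambda>p. walk_sq p q) has_real_derivative walk_sq_deriv p q) (at p within s)"
  "((\<lambda>p. fieldX p q) has_real_derivative fieldX_deriv p q) (at p within s)"
  "((\<lambda>p. fieldY p q) has_real_derivative fieldY_deriv p q) (at p within s)"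
  unfolding walk_sq_alt fieldX_def fieldY_def walk_sq_deriv_def fieldX_deriv_def fieldY_deriv_def
  by (auto intro!: derivative_eq_intros simp: algebra_simps)

lemma walk_sq_commute: "walk_sq p q = walk_sq q p"
  unfolding walk_sq_def by (metis
    (no_types, opaque_lifting) cos_minus minus_diff_eq mult.assoc mult.commute)

text \<open>The p-part of the divergence for \<open>g(P) = P^m\<close>. The exponents
  \<open>m - 1\<close> and \<open>m - 2\<close> are truncated only where a factor m or m - 1
  vanishes.\<close>

definition flux_deriv :: "nat \<Rightarrow> real \<Rightarrow> real \<Rightarrow> real" where
  "flux_deriv m p q = real m *
       (real (m - 1) * walk_sq p q ^ (m - 2) * walk_sq_deriv p q * fieldX p q
        + walk_sq p q ^ (m - 1) * fieldX_deriv p q)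
     + real m * walk_sq p q ^ (m - 1) * walk_sq_deriv p q * fieldY p q
       + walk_sq p q ^ m * fieldY_deriv p q"

lemma flux_has_derivative:
  "((\<lambda>p. real m * walk_sq p q ^ (m - 1) * fieldX p q + walk_sq p q ^ m * fieldY p q)
    has_real_derivative flux_deriv m p q) (at p within s)"
proof -
  have pw: "((\<lambda>p. walk_sq p q ^ k)
    has_real_derivative real k * walk_sq p q ^ (k - 1) * walk_sq_deriv p q) (at p within s)" for k
    using DERIV_power[OF field_derivs(1)[of q p s], of k] by (simp add: mult_ac)
  show ?thesis
    by (rule DERIV_cong[OF DERIV_add[OF DERIV_mult[OF DERIV_cmult[OF pw] field_derivs(2)]
      DERIV_mult[OF pw field_derivs(3)]]])
       (simp add: flux_deriv_def numeral_2_eq_2 algebra_simps)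
qed

text \<open>Taking P^m for g gives P^(m+1), P^m and P^(m-1) the coefficients m(m-1) + 3m + 1,
  -(10m(m-1) + 20m + 3) and 9m(m-1) + 9m, which are the polynomials of the moment
  recurrence.\<close>

lemma flux_divergence: "flux_deriv m p q + flux_deriv m q p =
   (real m + 1)^2 * walk_sq p q ^ (m+1) - (10 * real m^2 + 10 * real m + 3) * walk_sq p q ^ m
     + 9 * real m^2 * walk_sq p q ^ (m-1)"
proof -
  define P where "P = walk_sq p q"
  have P': "walk_sq q p = P" "walk_sq p q = P" by (auto simp: P_def walk_sq_commute)
  have "flux_deriv m p q + flux_deriv m q p
    = real m * real (m - 1) * P ^ (m - 2) * (walk_sq_deriv p q * fieldX p q
      + walk_sq_deriv q p * fieldX q p)
     + real m * P ^ (m - 1) * (fieldX_deriv p q + fieldX_deriv q p + walk_sq_deriv p q * fieldY p q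
       + walk_sq_deriv q p * fieldY q p) + P ^ m * (fieldY_deriv p q + fieldY_deriv q p)"
    unfolding flux_deriv_def P' by (simp add: algebra_simps)
  also have "\<dots> = real m * real (m - 1) * P ^ (m - 2) * (P * (P - 1) * (P - 9))
      + real m * P ^ (m - 1) * (3 * P ^ 2 - 20 * P + 9) + P ^ m * (P - 3)"
    unfolding grad_dot_fieldX div_fieldX div_fieldY P' ..
  also have "\<dots> = (real m + 1)^2 * P ^ (m+1) - (10 * real m^2 + 10 * real m + 3) * P ^ m
    + 9 * real m^2 * P ^ (m-1)"
  \<comment> \<open>m = 0 and m = 1 are treated apart because exponents are truncated there.\<close>
  proof (cases m)
    case (Suc k)
    thus ?thesis
      by (cases k) (simp_all add: algebra_simps power2_eq_square power3_eq_cube)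
  qed simp
  finally show ?thesis by (simp add: P')
qed

section \<open>Integration over the square and flux through its sides\<close>

definition square :: "(real \<times> real) set" where "square = cbox (0, 0) (pi/2, pi/2)"

definition square_integral ::
  "(real \<Rightarrow> real \<Rightarrow> 'a::euclidean_space) \<Rightarrow> 'a" where "square_integral f
    = integral square (\<lambda>(p, q). f p q)"

lemma walk_sq_cont [continuous_intros]:
  fixes f g :: "'a::t2_space \<Rightarrow> real"
  shows "continuous_on S f \<Longrightarrow> continuous_on S g \<Longrightarrow> continuous_on S (\<lambda>x. walk_sq (f x) (g x))"
  unfolding walk_sq_def by (auto intro!: continuous_intros)

lemma flux_deriv_cont [continuous_intros]:
  fixes f g :: "'a::t2_space \<Rightarrow> real"
  shows "continuous_on S f \<Longrightarrow> continuous_on S g \<Longrightarrow> continuous_on S (\<lambda>x. flux_deriv m (f x) (g x))"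
  unfolding flux_deriv_def walk_sq_def fieldX_def fieldY_def walk_sq_deriv_def fieldX_deriv_def
    fieldY_deriv_def by (intro continuous_intros) auto

text \<open>At p = 0 both field components vanish. At p = pi/2 the X part is 0 and P = 1, so only
  \<open>fieldY (pi/2) q\<close> is left, whatever m is; this makes the inhomogeneity of the
  recurrence constant.\<close>

lemma flux_through_side: "integral {0..pi/2} (\<lambda>p. flux_deriv m p q) = sin (2 * q)"
proof -
  have "((\<lambda>p. flux_deriv m p q) has_integral
     (real m * walk_sq (pi/2) q ^ (m - 1) * fieldX (pi/2) q
       + walk_sq (pi/2) q ^ m * fieldY (pi/2) q)
    - (real m * walk_sq 0 q ^ (m - 1) * fieldX 0 q + walk_sq 0 q ^ m * fieldY 0 q)) {0..pi/2}"
    by (rule fundamental_theorem_of_calculus)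
       (use flux_has_derivative in \<open>auto simp flip: has_real_derivative_iff_has_vector_derivative
         simp del: One_nat_def\<close>)
  moreover have "walk_sq (pi/2) q = 1" by (simp add: walk_sq_def)
  moreover have s: "sin (2*pi - x) = - sin x" "sin (2*pi + x) = sin x" for x
    by (simp_all add: sin_diff sin_add)
  have "fieldX (pi/2) q = 0" by (simp add: fieldX_def s)
  moreover have "fieldY (pi/2) q = sin (2 * q)" by (simp add: fieldY_def)
  moreover have "fieldX 0 q = 0" "fieldY 0 q = 0" by (simp_all add: fieldX_def fieldY_def)
  ultimately show ?thesis by (simp add: integral_unique)
qed

lemma integral_sin_double: "integral {0..pi/2} (\<lambda>q. sin (2 * q)) = 1"
proof -
  have "((\<lambda>q. sin (2 * q)) has_integral (- cos (2 * (pi/2)) / 2) - (- cos (2 * 0) / 2)) {0..pi/2}"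
    by (rule fundamental_theorem_of_calculus)
       (auto intro!: derivative_eq_intros simp flip: has_real_derivative_iff_has_vector_derivative)
  thus ?thesis by (simp add: integral_unique)
qed

lemma square_integral_iterated:
  assumes "continuous_on square (\<lambda>(p, q). f p q)"
  shows "square_integral f = integral {0..pi/2} (\<lambda>p. integral {0..pi/2} (f p))"
    "square_integral f = integral {0..pi/2} (\<lambda>q. integral {0..pi/2} (\<lambda>p. f p q))"
proof -
  show "square_integral f = integral {0..pi/2} (\<lambda>p. integral {0..pi/2} (f p))"
    using integral_prod_continuous[of 0 0 "pi/2" "pi/2" "\<lambda>(p, q). f p q"] assms
      by (simp add: square_def square_integral_def)
  also have "\<dots> = integral {0..pi/2} (\<lambda>q. integral {0..pi/2} (\<lambda>p. f p q))"
    using integral_swap_continuous[of 0 0 "pi/2" "pi/2" f] assms by (simp add: square_def)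
  finally show "square_integral f = integral {0..pi/2} (\<lambda>q. integral {0..pi/2} (\<lambda>p. f p q))" .
qed

lemma square_integrable:
  fixes f :: "real \<Rightarrow> real \<Rightarrow> 'a::euclidean_space"
  shows "continuous_on square (\<lambda>(p, q). f p q) \<Longrightarrow> (\<lambda>(p, q). f p q) integrable_on square"
  unfolding square_def by (rule integrable_continuous)

text \<open>Integrating first in the variable of differentiation reduces to
  \<open>flux_through_side\<close>, so the two parts need opposite orders of iteration.\<close>

lemma square_integral_flux:
  "square_integral (flux_deriv m) = 1" "square_integral (\<lambda>p q. flux_deriv m q p) = 1"
  by (subst square_integral_iterated;
    (auto intro!: continuous_intros simp: case_prod_unfold flux_through_side
      integral_sin_double)[1])+

text \<open>In half angles the torus is a period square of area pi^2, and the region P > 1 amounts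
  to three copies of \<open>square\<close>; hence the factor 3/pi^2.\<close>

definition moment ::
  "nat \<Rightarrow> real" where "moment n = 3 / pi\<^sup>2 * square_integral (\<lambda>p q. walk_sq p q ^ n)"

lemma moment_0: "moment 0 = 3/4"
  by (simp add: moment_def square_integral_def square_def case_prod_unfold content_Pair
    power2_eq_square)

text \<open>The divergence integrates to 2, with 1 from each of the sides p = pi/2 and q = pi/2. At
  m = 0 the truncated index \<open>m - 1\<close> is harmless because of the factor m^2.\<close>

lemma moment_recurrence:
  "(real m + 1)^2 * moment (m+1) - (10 * real m^2 + 10 * real m + 3) * moment m
    + 9 * real m^2 * moment (m-1) = 6 / pi\<^sup>2"
proof -
  have i: "(\<lambda>(p, q). walk_sq p q ^ k) integrable_on square"
    "(\<lambda>(p, q). flux_deriv k p q) integrable_on square"  "(\<lambda>(p, q). flux_deriv k q p) integrable_on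
      square" for k
    by (intro square_integrable continuous_intros; auto intro!: continuous_intros simp:
      case_prod_unfold)+
  have h: "((\<lambda>z. walk_sq (fst z) (snd z) ^ k)
    has_integral square_integral (\<lambda>p q. walk_sq p q ^ k)) square" for k
    using integrable_integral[OF i(1)] by (simp add: square_integral_def case_prod_unfold)
  have "((\<lambda>z. flux_deriv m (fst z) (snd z) + flux_deriv m (snd z) (fst z)) has_integral 2) square"
    unfolding one_add_one[symmetric]
    using integrable_integral[OF i(2)] integrable_integral[OF i(3)] square_integral_flux
    by (intro has_integral_add) (simp_all add: square_integral_def case_prod_unfold)
  moreover have "((\<lambda>z. flux_deriv m (fst z) (snd z) + flux_deriv m (snd z) (fst z)) has_integral
     (real m + 1)^2 * square_integral (\<lambda>p q. walk_sq p q ^ (m+1)) - (10 * real m^2 + 10 * real m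
       + 3) * square_integral (\<lambda>p q. walk_sq p q ^ m)
         + 9 * real m^2 * square_integral (\<lambda>p q. walk_sq p q ^ (m-1))) square"
    unfolding flux_divergence by
      (intro has_integral_add has_integral_diff has_integral_mult_right h)
  ultimately have "2 = (real m + 1)^2 * square_integral (\<lambda>p q. walk_sq p q ^ (m+1)) - (10 * real m^2
    + 10 * real m + 3) * square_integral (\<lambda>p q. walk_sq p q ^ m)
      + 9 * real m^2 * square_integral (\<lambda>p q. walk_sq p q ^ (m-1))"
    by (rule has_integral_unique)
  hence "6 / pi\<^sup>2 = 3 / pi\<^sup>2 * ((real m + 1)^2 * square_integral (\<lambda>p q. walk_sq p q ^ (m+1))
    - (10 * real m^2 + 10 * real m + 3) * square_integral (\<lambda>p q. walk_sq p q ^ m)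
      + 9 * real m^2 * square_integral (\<lambda>p q. walk_sq p q ^ (m-1)))" by simp
  thus ?thesis unfolding moment_def by (simp add: algebra_simps)
qed

subsection \<open>Taylor coefficients of the solutions\<close>

lemma theta_fps: "f has_fps_expansion F \<Longrightarrow> theta f has_fps_expansion fps_X * fps_deriv F"
  unfolding theta_def by (intro fps_expansion_intros)

lemma fps_theta_nth: "(fps_X * fps_deriv F) $ n = of_nat n * (F $ n :: complex)"
  by (cases n) auto

text \<open>\<open>theta\<close> multiplies the n-th Taylor coefficient by n and t shifts
  coefficients, so this compares the coefficients of t^(n+1) in \<open>L2 f = g\<close>. The factor
  9(k+1)^2 at k = n - 1 is 9n^2, which also removes the truncated index at n = 0.\<close>

lemma L2_coeffs:
  fixes f g :: "complex \<Rightarrow> complex"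
  assumes "r > 0" "f holomorphic_on ball 0 r" "\<forall>t\<in>ball 0 r. L2 f t = g t" "g has_fps_expansion G"
  defines "c \<equiv> \<lambda>n. (deriv ^^ n) f 0 / fact n"
  shows "(of_nat n + 1)\<^sup>2 * c (n + 1) - (10 * of_nat n ^ 2 + 10 * of_nat n + 3) * c n
    + 9 * of_nat n ^ 2 * c (n - 1) = G $ (n + 1)"
proof -
  define F where "F = fps_expansion f 0"
  have F: "f has_fps_expansion F"
    unfolding F_def using assms(1,2) by (intro has_fps_expansion_fps_expansion[of "ball 0 r"]) auto
  define D where "D = (\<lambda>F :: complex fps. fps_X * fps_deriv F)"
  have D: "theta h has_fps_expansion D H" if "h has_fps_expansion H" for h H
    unfolding D_def using theta_fps that .
  have Dn: "D H $ n = of_nat n * H $ n" for H n unfolding D_def by (rule fps_theta_nth)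
  define R where "R = D (D F) - fps_X * (fps_const 10 * D (D F) + fps_const 10 * D F
    + fps_const 3 * F)
      + (fps_const 9 * fps_X^2) * (D (D F) + fps_const 2 * D F + F)"
  have "L2 f has_fps_expansion R"
    unfolding L2_def R_def by (intro fps_expansion_intros D F)
  moreover have "L2 f has_fps_expansion G"
  proof -
    have "eventually (\<lambda>t. t \<in> ball 0 r) (nhds (0::complex))"
      using assms(1) by (intro eventually_nhds_in_open) auto
    hence "eventually (\<lambda>t. L2 f t = g t) (nhds 0)" by eventually_elim (use assms in auto)
    thus ?thesis using assms(4) has_fps_expansion_cong by blast
  qed
  ultimately have "G = R" by (rule fps_expansion_unique_complex[symmetric])
  moreover have "c n = F $ n" for n
    unfolding c_def using fps_nth_fps_expansion[OF F] by simp
  moreover have "R $ (n + 1)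
    = (of_nat n + 1)\<^sup>2 * F $ (n+1) - (10 * of_nat n ^ 2 + 10 * of_nat n + 3) * F $ n
      + 9 * of_nat n ^ 2 * F $ (n - 1)"
    unfolding R_def fps_add_nth fps_sub_nth fps_X_mult_nth fps_mult_left_const_nth mult.assoc[of
      "fps_const 9"] fps_X_power_mult_nth Dn
    by (cases n) (simp_all add: algebra_simps power2_eq_square)
  ultimately show ?thesis by simp
qed

lemma geometric_fps: "(\<lambda>t::complex. t / (1 - t)) has_fps_expansion fps_X * inverse (1 - fps_X)"
  unfolding divide_inverse by (intro fps_expansion_intros) auto

lemma geometric_fps_nth: "(fps_X * inverse (1 - fps_X) :: complex fps) $ (n + 1) = 1"
  by (simp add: fps_inverse_gp' flip: fps_inverse_gp')

text \<open>\<open>phi\<close> satisfies the recurrence with right-hand side 0 and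
  \<open>psi\<close> with 1, so the combination has 6/pi^2, as the moments do. Both sequences start
  with 3/4, and the nonzero leading coefficient (n+1)^2 determines the rest.\<close>

lemma taylor_coeffs_eq_moment:
  fixes phi psi :: "complex \<Rightarrow> complex" and r :: real
  assumes "r > 0" "phi holomorphic_on ball 0 r" "psi holomorphic_on ball 0 r"
    "\<forall>t\<in>ball 0 r. L2 phi t = 0" "\<forall>t\<in>ball 0 r. L2 psi t = t / (1 - t)"
    "phi 0 = 1" "psi 0 = 0"
  shows "(deriv ^^ n) (\<lambda>t. 3/4 * phi t + 6 / pi^2 * psi t) 0 / fact n = of_real (moment n)"
proof -
  define c where "c = (\<lambda>n. (deriv ^^ n) phi 0 / fact n)"
  define d where "d = (\<lambda>n. (deriv ^^ n) psi 0 / fact n)"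
  define b where "b = (\<lambda>n. (deriv ^^ n) (\<lambda>t. 3/4 * phi t + 6 / pi^2 * psi t) 0 / fact n)"
  have E: "phi has_fps_expansion fps_expansion phi 0" "psi has_fps_expansion fps_expansion psi 0"
    using assms by (auto intro!: has_fps_expansion_fps_expansion[of "ball 0 r"])
  have "(\<lambda>t. 3/4 * phi t + 6 / pi^2 * psi t)
    has_fps_expansion fps_const (3/4) * fps_expansion phi 0
      + fps_const (6/pi^2) * fps_expansion psi 0"
    by (intro has_fps_expansion_add has_fps_expansion_cmult_left E)
  from fps_nth_fps_expansion[OF this] have b: "b n = 3/4 * c n + 6/pi^2 * d n" for n
    unfolding b_def c_def d_def
      by (simp add: fps_nth_fps_expansion[OF E(1)] fps_nth_fps_expansion[OF E(2)])
  have rc: "(of_nat n + 1)\<^sup>2 * c (n + 1) - (10 * of_nat n ^ 2 + 10 * of_nat n + 3) * c n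
    + 9 * of_nat n ^ 2 * c (n - 1) = 0" for n
    unfolding c_def using L2_coeffs[OF assms(1,2,4) has_fps_expansion_0, of n] by simp
  have rd: "(of_nat n + 1)\<^sup>2 * d (n + 1) - (10 * of_nat n ^ 2 + 10 * of_nat n + 3) * d n
    + 9 * of_nat n ^ 2 * d (n - 1) = 1" for n
    unfolding d_def using L2_coeffs[OF assms(1,3,5) geometric_fps, of n]
      unfolding geometric_fps_nth .
  have rb: "(of_nat n + 1)\<^sup>2 * b (n + 1) - (10 * of_nat n ^ 2 + 10 * of_nat n + 3) * b n
    + 9 * of_nat n ^ 2 * b (n - 1) = 6/pi^2" for n
  proof -
    have "(of_nat n + 1)\<^sup>2 * b (n + 1) - (10 * of_nat n ^ 2 + 10 * of_nat n + 3) * b n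
      + 9 * of_nat n ^ 2 * b (n - 1)
     = 3/4 * ((of_nat n + 1)\<^sup>2 * c (n + 1) - (10 * of_nat n ^ 2 + 10 * of_nat n + 3) * c n
       + 9 * of_nat n ^ 2 * c (n - 1))
       + 6/pi^2 * ((of_nat n + 1)\<^sup>2 * d (n + 1) - (10 * of_nat n ^ 2 + 10 * of_nat n + 3) * d n
         + 9 * of_nat n ^ 2 * d (n - 1))"
    proof -
      have "A * (h * c1 + k * d1) - B * (h * c0 + k * d0) + E * (h * c2 + k * d2)
          = h * (A * c1 - B * c0 + E * c2) + k * (A * d1 - B * d0 + E * d2)"
        for A B E h k c0 c1 c2 d0 d1 d2 :: complex
        by (simp add: algebra_simps)
      thus ?thesis unfolding b .
    qed
    thus ?thesis unfolding rc rd by simp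
  qed
  have rm: "(of_nat n + 1)\<^sup>2 * complex_of_real (moment (n + 1)) - (10 * of_nat n ^ 2 + 10 * of_nat n
    + 3) * of_real (moment n) + 9 * of_nat n ^ 2 * of_real (moment (n - 1)) = 6/pi^2" for n
    using arg_cong[OF moment_recurrence[of n], of complex_of_real] by simp
  have "b n = of_real (moment n)"
  proof (induction n rule: less_induct)
    case (less n)
    show ?case
    proof (cases n)
      case 0
      thus ?thesis using b[of 0] assms by (simp add: c_def d_def moment_0)
    next
      case (Suc k)
      have 1: "b k = of_real (moment k)" "b (k - 1) = of_real (moment (k - 1))" using less Suc
        by auto
      have "(of_nat k + 1)\<^sup>2 * b (k + 1) = (of_nat k + 1)\<^sup>2 * of_real (moment (k + 1))"
        using rb[of k] rm[of k] unfolding 1 by (metis add_right_cancel diff_add_cancel)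
      moreover have "(of_nat k + 1 :: complex) \<noteq> 0"
        by (metis of_nat_Suc of_nat_eq_0_iff add.commute nat.distinct(2))
      ultimately show ?thesis using Suc by simp
    qed
  qed
  thus ?thesis by (simp add: b_def)
qed

subsection \<open>Analytic continuation and the limit\<close>

text \<open>On the square p, q and p - q lie in [-pi/2, pi/2], so all three cosines are in
  [0, 1].\<close>

lemma walk_sq_bounds:
  assumes "(p, q) \<in> square"
  shows "1 \<le> walk_sq p q" "walk_sq p q \<le> 9"
proof -
  have pq: "0 \<le> p" "p \<le> pi/2" "0 \<le> q" "q \<le> pi/2" using assms by (auto simp: square_def)
  have c: "0 \<le> cos p" "0 \<le> cos q" "0 \<le> cos (p - q)" using pq by (auto intro!: cos_ge_zero)
  show "1 \<le> walk_sq p q" using c by (simp add: walk_sq_def)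
  have "cos p * cos q * cos (p - q) \<le> 1 * 1 * 1"
    using c by (intro mult_mono mult_nonneg_nonneg) auto
  thus "walk_sq p q \<le> 9" by (simp add: walk_sq_def)
qed

text \<open>For P in [1, 9] the number 1 - tP meets the branch cut of \<open>Ln\<close> only if t is
  real and at least 1/P, hence at least 1/9.\<close>

definition slit_plane :: "complex set" where "slit_plane = {t. Im t = 0 \<longrightarrow> Re t < 1/9}"

lemma open_slit_plane: "open slit_plane"
proof -
  have "slit_plane = - ({t. Im t = 0} \<inter> {t. Re t \<ge> 1/9})" by (auto simp: slit_plane_def)
  moreover have "closed ({t. Im t = 0} \<inter> {t. Re t \<ge> 1/9})"
    by (intro closed_Int closed_Collect_eq closed_Collect_le continuous_intros)
  ultimately show ?thesis by (metis open_Compl)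
qed

text \<open>Star-shapedness about 0, from which connectedness of the domains is deduced.\<close>

lemma slit_plane_scale:
  assumes "t \<in> slit_plane" "0 \<le> u" "u \<le> 1"
  shows "of_real u * t \<in> slit_plane"
proof (cases "u = 0")
  case False
  hence "u > 0" using assms by simp
  have "u * Re t < 1/9" if "Re t < 1/9"
  proof (cases "Re t \<ge> 0")
    case True
    thus ?thesis using mult_right_mono[of u 1 "Re t"] assms that by simp
  next
    case False
    hence "u * Re t < 0" using \<open>u > 0\<close> by (simp add: mult_pos_neg)
    thus ?thesis by simp
  qed
  thus ?thesis using assms False by (auto simp: slit_plane_def)
qed (simp add: slit_plane_def)

lemma slit_plane_not_nonpos:
  assumes "t \<in> slit_plane" "1 \<le> P" "P \<le> 9"
  shows "1 - t * of_real P \<notin> \<real>\<^sub>\<le>\<^sub>0"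
proof
  assume "1 - t * of_real P \<in> \<real>\<^sub>\<le>\<^sub>0"
  hence "Im t * P = 0" "Re t * P \<ge> 1" by (auto simp: complex_nonpos_Reals_iff)
  moreover from this assms have "Re t < 1/9" by (auto simp: slit_plane_def)
  moreover have "Re t * P < 1"
  proof (cases "Re t \<ge> 0")
    case True
    hence "Re t * P \<le> Re t * 9" using assms by (intro mult_left_mono) auto
    thus ?thesis using \<open>Re t < 1/9\<close> by simp
  next
    case False
    thus ?thesis using assms mult_nonpos_nonneg[of "Re t" P] by simp
  qed
  ultimately show False by simp
qed

text \<open>The non-logarithmic part of the inverse theta, as -log(1 - tP) is the sum of (tP)^n / n
  over n >= 1. The integral provides the continuation of that series to
  \<open>slit_plane\<close>.\<close>

definition log_potential :: "complex \<Rightarrow> complex" where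
  "log_potential t = - (3 / complex_of_real pi ^ 2) * square_integral (\<lambda>p q. Ln (1
    - t * complex_of_real (walk_sq p q)))"

text \<open>Differentiation under the integral sign, carried out on balls because the Leibniz rule
  asks for a convex domain and \<open>slit_plane\<close> is not convex.\<close>

lemma log_potential_holomorphic: "log_potential holomorphic_on slit_plane"
proof -
  have "\<exists>e>0. (\<lambda>t. square_integral (\<lambda>p q. Ln (1
    - t * complex_of_real (walk_sq p q)))) holomorphic_on ball t0 e" if "t0 \<in> slit_plane" for t0
  proof -
    from that open_slit_plane obtain e where e: "e > 0" "ball t0 e \<subseteq> slit_plane"
      using openE by blast
    define f where "f = (\<lambda>t (z::real\<times>real). Ln (1 - t * complex_of_real (walk_sq (fst z) (snd z))))"
    define f' where "f' = (\<lambda>t (z::real\<times>real). - complex_of_real (walk_sq (fst z) (snd z)) / (1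
      - t * complex_of_real (walk_sq (fst z) (snd z))))"
    have nz: "1 - t * complex_of_real (walk_sq (fst z) (snd z)) \<notin> \<real>\<^sub>\<le>\<^sub>0"
      if "t \<in> ball t0 e" "z \<in> square" for t z
      using that e walk_sq_bounds[of "fst z" "snd z"] by (intro slit_plane_not_nonpos) auto
    have "(\<lambda>t. integral square (f t)) holomorphic_on ball t0 e"
      unfolding square_def
    proof (rule leibniz_rule_holomorphic[where fx = f'], unfold square_def[symmetric])
      fix t z assume tz: "t \<in> ball t0 e" "z \<in> square"
      show "((\<lambda>t. f t z) has_field_derivative f' t z) (at t within ball t0 e)"
        unfolding f_def f'_def using nz[OF tz]
        by (auto intro!: derivative_eq_intros simp: divide_inverse)
    next
      fix t assume t: "t \<in> ball t0 e"
      show "f t integrable_on square" unfolding square_def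
        by (rule integrable_continuous, unfold square_def[symmetric] f_def)
           (use nz[OF t] in \<open>auto intro!: continuous_intros\<close>)
    next
      have "1 - t * complex_of_real (walk_sq (fst z) (snd z)) \<noteq> 0" if "t \<in> ball t0 e" "z \<in> square"
        for t z
        using nz[OF that] by (metis nonpos_Reals_zero_I)
      thus "continuous_on (ball t0 e \<times> square) (\<lambda>(t, z). f' t z)"
        unfolding f'_def case_prod_unfold
          by (auto intro!: continuous_intros simp del: right_minus_eq)
    qed auto
    moreover have "square_integral (\<lambda>p q. Ln (1 - t * complex_of_real (walk_sq p q)))
      = integral square (f t)" for t
      by (simp add: square_integral_def f_def case_prod_unfold)
    ultimately show ?thesis using e by auto
  qed
  hence "(\<lambda>t. square_integral (\<lambda>p q. Ln (1
    - t * complex_of_real (walk_sq p q)))) analytic_on slit_plane"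
    unfolding analytic_on_def by blast
  hence "(\<lambda>t. square_integral (\<lambda>p q. Ln (1
    - t * complex_of_real (walk_sq p q)))) holomorphic_on slit_plane"
    by (rule analytic_imp_holomorphic)
  thus ?thesis unfolding log_potential_def by (intro holomorphic_intros)
qed

text \<open>As |tP| <= 9|t| < 1, the logarithm series converges uniformly on the square and can be
  integrated termwise. The term at n = 0 is 0 because division by 0 yields 0.\<close>

lemma log_potential_sums:
  assumes "norm t < 1/9"
  shows "(\<lambda>n. of_real (moment n) / of_nat n * t ^ n) sums log_potential t"
proof -
  define f where "f = (\<lambda>n (z::real\<times>real).
    - ((t * complex_of_real (walk_sq (fst z) (snd z))) ^ n / of_nat n))"
  have b: "norm (t * complex_of_real (walk_sq (fst z) (snd z))) \<le> 9 * norm t" if "z \<in> square" for z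
    using walk_sq_bounds[of "fst z" "snd z"] that
      by (simp add: norm_mult mult.commute[of 9] mult_left_mono)
  have s: "(\<lambda>n. f n z) sums Ln (1 - t * complex_of_real (walk_sq (fst z) (snd z)))" if "z \<in> square"
    for z
    using Ln_series'[of "- (t * complex_of_real (walk_sq (fst z) (snd z)))"] b[OF that] assms
    by (simp add: f_def)
  have ul: "uniform_limit square (\<lambda>N z. \<Sum>n<N. f n z) (\<lambda>z. \<Sum>n. f n z) sequentially"
  proof (rule Weierstrass_m_test)
    show "summable (\<lambda>n. (9 * norm t) ^ n)" using assms by (intro summable_geometric) auto
    fix n z assume z: "z \<in> square"
    have "norm (f n z) = norm (t * complex_of_real (walk_sq (fst z) (snd z))) ^ n / real n"
      by (simp add: f_def norm_divide norm_power)
    also have "\<dots> \<le> norm (t * complex_of_real (walk_sq (fst z) (snd z))) ^ n / 1"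
    proof (cases "n = 0")
      case False
      thus ?thesis by (intro divide_left_mono) auto
    qed simp
    also have "\<dots> \<le> (9 * norm t) ^ n" using power_mono[OF b[OF z], of n] by simp
    finally show "norm (f n z) \<le> (9 * norm t) ^ n" .
  qed
  have c: "continuous_on square (f n)" for n
    unfolding f_def by (cases "n = 0") (auto intro!: continuous_intros)
  have cs: "continuous_on square (\<lambda>z. \<Sum>n<N. f n z)" for N by (intro continuous_on_sum c)
  obtain I J where IJ: "\<And>N. ((\<lambda>z. \<Sum>n<N. f n z) has_integral I N) square"
      "((\<lambda>z. \<Sum>n. f n z) has_integral J) square" "I \<longlonglongrightarrow> J"
    using uniform_limit_integral_cbox[OF ul[unfolded square_def] cs[unfolded square_def]]
      unfolding square_def by auto
  have J: "J = square_integral (\<lambda>p q. Ln (1 - t * complex_of_real (walk_sq p q)))"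
  proof -
    have "integral square (\<lambda>z. Ln (1 - t * complex_of_real (walk_sq (fst z) (snd z))))
      = integral square (\<lambda>z. \<Sum>n. f n z)"
      using s by (intro integral_cong) (simp add: sums_iff)
    thus ?thesis using IJ(2) by (simp add: square_integral_def case_prod_unfold integral_unique)
  qed
  have fi: "(f n has_integral
    - (t ^ n / of_nat n) * of_real (square_integral (\<lambda>p q. walk_sq p q ^ n))) square" for n
  proof -
    have "((\<lambda>z. walk_sq (fst z) (snd z) ^ n)
      has_integral square_integral (\<lambda>p q. walk_sq p q ^ n)) square"
      using integrable_integral[OF square_integrable[of "\<lambda>p q. walk_sq p q ^ n"]]
      by (simp add: square_integral_def case_prod_unfold continuous_intros)
    from has_integral_mult_right[OF has_integral_of_real[OF this, where 'b=complex], of "-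
      (t ^ n / of_nat n)"]
    show ?thesis by (simp add: f_def power_mult_distrib)
  qed
  have "I = (\<lambda>N. \<Sum>n<N. - (t ^ n / of_nat n) * of_real (square_integral (\<lambda>p q. walk_sq p q ^ n)))"
    by (rule ext, rule has_integral_unique[OF IJ(1) has_integral_sum[OF _ fi]]) simp
  hence "(\<lambda>n. - (t ^ n / of_nat n)
    * of_real (square_integral (\<lambda>p q. walk_sq p q ^ n))) sums square_integral (\<lambda>p q. Ln (1
      - t * complex_of_real (walk_sq p q)))"
    using IJ(3) unfolding sums_def J by simp
  from sums_mult[OF this, of "- (3 / complex_of_real pi ^ 2)"] show ?thesis
    unfolding log_potential_def moment_def by (simp add: mult_ac)
qed

text \<open>The value at which both sides of the theorem meet: the limit at minus infinity and the
  Mahler measure.\<close>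

definition log_moment :: real where
  "log_moment = 3 / pi\<^sup>2 * square_integral (\<lambda>p q. ln (walk_sq p q))"

text \<open>Factor 1 - xP as -x times P + 1/(-x). The square has area pi^2/4, so ln(-x) enters with
  weight 3/pi^2 times pi^2/4, that is 3/4, and cancels the explicit logarithm.\<close>

lemma log_potential_negative_real:
  assumes "x < 0"
  shows "- (3/4 * ln (-x)) - Re (log_potential (of_real x))
    = 3 / pi\<^sup>2 * square_integral (\<lambda>p q. ln (walk_sq p q + inverse (-x)))"
proof -
  have pos: "walk_sq p q + inverse (-x) > 0" if "(p, q) \<in> square" for p q
    using walk_sq_bounds(1)[OF that] assms by (smt (verit) inverse_positive_iff_positive)
  have i: "(\<lambda>(p, q). ln (walk_sq p q + inverse (-x))) integrable_on square"
    using pos by (intro square_integrable)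
      (auto intro!: continuous_intros simp: case_prod_unfold less_imp_neq[THEN not_sym])
  have "((\<lambda>(p, q). ln (walk_sq p q + inverse (-x)) + ln (-x))
    has_integral square_integral (\<lambda>p q. ln (walk_sq p q + inverse (-x))) + pi^2/4 * ln (-x)) square"
  proof -
    have "((\<lambda>z. ln (-x)) has_integral pi^2/4 * ln (-x)) square"
      unfolding square_def using has_integral_const[of "ln (-x)" "(0,0)" "(pi/2,pi/2)"]
        by (simp add: content_Pair power2_eq_square)
    then show ?thesis
      using has_integral_add[OF integrable_integral[OF i], of "\<lambda>z. ln (-x)"]
        by (simp add: square_integral_def case_prod_unfold)
  qed
  from has_integral_of_real[OF this, where 'b = complex]
  have "((\<lambda>(p, q). Ln (1 - complex_of_real x * complex_of_real (walk_sq p q)))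
    has_integral complex_of_real (square_integral (\<lambda>p q. ln (walk_sq p q + inverse (-x)))
      + pi^2/4 * ln (-x))) square"
  proof (rule has_integral_eq[rotated])
    fix z assume "z \<in> square"
    obtain p q where z: "z = (p, q)" by force
    from \<open>z \<in> square\<close> z have P: "walk_sq p q + inverse (-x) > 0" using pos by auto
    have e1: "1 - x * walk_sq p q = (walk_sq p q + inverse (-x)) * (-x)" using assms
      by (simp add: field_simps)
    have "1 - x * walk_sq p q > 0" unfolding e1 using P assms by (intro mult_pos_pos) auto
    moreover have "ln (1 - x * walk_sq p q) = ln (walk_sq p q + inverse (-x)) + ln (-x)"
      unfolding e1 using assms by (intro ln_mult_pos P) simp
    ultimately have "Ln (1 - of_real x * of_real (walk_sq p q))
      = of_real (ln (walk_sq p q + inverse (-x)) + ln (-x))"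
      using Ln_of_real[of "1 - x * walk_sq p q"] by simp
    thus "of_real (case z of (p, q) \<Rightarrow> ln (walk_sq p q + inverse (-x)) + ln (-x))
      = (case z of (p, q) \<Rightarrow> Ln (1 - complex_of_real x * complex_of_real (walk_sq p q)))"
      using z by simp
  qed
  hence "square_integral (\<lambda>p q. Ln (1 - complex_of_real x * complex_of_real (walk_sq p q)))
    = complex_of_real (square_integral (\<lambda>p q. ln (walk_sq p q + inverse (-x))) + pi^2/4 * ln (-x))"
    unfolding square_integral_def by (rule integral_unique)
  hence "log_potential (of_real x)
    = of_real (- (3 / pi^2) * (square_integral (\<lambda>p q. ln (walk_sq p q + inverse (-x)))
      + pi^2/4 * ln (-x)))"
    unfolding log_potential_def by simp
  hence "Re (log_potential (of_real x))
    = - (3 / pi^2) * (square_integral (\<lambda>p q. ln (walk_sq p q + inverse (-x))) + pi^2/4 * ln (-x))"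
    by (metis Re_complex_of_real)
  thus ?thesis by (simp add: algebra_simps)
qed

text \<open>Since P >= 1, ln(P + e) - ln P = ln(1 + e/P) <= e, so the integrals differ by at most e
  times the area pi^2/4.\<close>

lemma log_potential_limit:
  "((\<lambda>x. 3 / pi\<^sup>2 * square_integral (\<lambda>p q. ln (walk_sq p q + inverse (-x)))) \<longlongrightarrow> log_moment) at_bot"
proof -
  have b: "\<bar>square_integral (\<lambda>p q. ln (walk_sq p q + inverse (-x)))
    - square_integral (\<lambda>p q. ln (walk_sq p q))\<bar> \<le> pi^2/4 * inverse (-x)" if "x < 0" for x :: real
  proof -
    define e where "e = inverse (-x)"
    have e: "e > 0" using that by (simp add: e_def)
    have i: "(\<lambda>(p, q). ln (walk_sq p q + c)) integrable_on square" if "c \<ge> 0" for c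
    proof (intro square_integrable)
      have "walk_sq (fst z) (snd z) + c \<noteq> 0" if "z \<in> square" for z
        using walk_sq_bounds(1)[of "fst z" "snd z"] that \<open>c \<ge> 0\<close> by auto
      thus "continuous_on square (\<lambda>(p, q). ln (walk_sq p q + c))" unfolding case_prod_unfold
        by (intro continuous_intros) auto
    qed
    have "square_integral (\<lambda>p q. ln (walk_sq p q + e)) - square_integral (\<lambda>p q. ln (walk_sq p q))
      = integral square (\<lambda>(p, q). ln (walk_sq p q + e) - ln (walk_sq p q))"
      using i[of e] i[of 0] e unfolding square_integral_def case_prod_unfold
        by (simp add: integral_diff)
    moreover have "norm (integral square (\<lambda>(p, q). ln (walk_sq p q + e) - ln (walk_sq p q)))
      \<le> integral square (\<lambda>z. e)"
    proof (rule integral_norm_bound_integral)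
      show "(\<lambda>(p, q). ln (walk_sq p q + e) - ln (walk_sq p q)) integrable_on square"
        using integrable_diff[OF i[of e] i[of 0]] e unfolding case_prod_unfold by simp
      show "(\<lambda>z. e) integrable_on square" by (simp add: square_def integrable_const)
      fix z assume "z \<in> square"
      obtain p q where z: "z = (p, q)" by force
      from \<open>z \<in> square\<close> z have P: "walk_sq p q \<ge> 1" using walk_sq_bounds by auto
      have "ln (walk_sq p q + e) - ln (walk_sq p q) = ln (1 + e / walk_sq p q)"
        using ln_divide_pos[of "walk_sq p q + e" "walk_sq p q"] P e
          by (simp add: add_divide_distrib)
      also have "\<dots> \<le> e / walk_sq p q" using P e by (intro ln_add_one_self_le_self) auto
      also have "\<dots> \<le> e / 1" using P e by (intro divide_left_mono) auto
      finally show "norm (case z of (p, q) \<Rightarrow> ln (walk_sq p q + e) - ln (walk_sq p q)) \<le> e"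
        using z P e by simp
    qed
    ultimately show ?thesis by (simp add: square_def content_Pair power2_eq_square e_def)
  qed
  have "((\<lambda>x. square_integral (\<lambda>p q. ln (walk_sq p q + inverse (-x)))
    - square_integral (\<lambda>p q. ln (walk_sq p q))) \<longlongrightarrow> 0) at_bot"
  proof (rule Lim_null_comparison)
    show "eventually (\<lambda>x. norm (square_integral (\<lambda>p q. ln (walk_sq p q + inverse (-x)))
      - square_integral (\<lambda>p q. ln (walk_sq p q))) \<le> pi^2/4 * inverse (-x)) at_bot"
      using eventually_gt_at_bot[of 0] eventually_at_bot_linorder b
      by (metis (mono_tags, lifting) real_norm_def eventually_at_bot_dense)
    have "((\<lambda>x::real. inverse (-x)) \<longlongrightarrow> 0) at_bot"
      by (intro tendsto_inverse_0_at_top filterlim_uminus_at_top_at_bot)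
    thus "((\<lambda>x::real. pi^2/4 * inverse (-x)) \<longlongrightarrow> 0) at_bot" by (rule tendsto_mult_right_zero)
  qed
  hence "((\<lambda>x. square_integral (\<lambda>p q. ln (walk_sq p q
    + inverse (-x)))) \<longlongrightarrow> square_integral (\<lambda>p q. ln (walk_sq p q))) at_bot"
    by (simp add: LIM_zero_iff)
  thus ?thesis unfolding log_moment_def by (intro tendsto_intros)
qed

subsection \<open>Reduction of the torus to the square\<close>

text \<open>Extends log P by 0 outside the region P > 1. The result is continuous, so integrals over
  the hexagonal region become integrals over full periods.\<close>

definition log_plus_walk ::
  "real \<Rightarrow> real \<Rightarrow> real" where "log_plus_walk p q = ln (max 1 (walk_sq p q))"

lemma log_plus_walk_cont [continuous_intros]:
  fixes f g :: "'a::t2_space \<Rightarrow> real"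
  shows "continuous_on S f \<Longrightarrow> continuous_on S g \<Longrightarrow> continuous_on S (\<lambda>x. log_plus_walk (f x) (g x))"
  unfolding log_plus_walk_def by (auto intro!: continuous_intros)

text \<open>Fubini on the triangle 0 <= p <= r <= c. The kernel cut off to this compact set is
  integrable on the plane, although no longer continuous.\<close>

lemma triangle_swap:
  fixes K :: "real \<Rightarrow> real \<Rightarrow> real"
  assumes "continuous_on UNIV (\<lambda>(x, y). K x y)"
  shows "(\<lambda>p. integral {p..c} (\<lambda>r. K p r)) integrable_on {0..c}"
    "(\<lambda>r. integral {0..r} (\<lambda>p. K p r)) integrable_on {0..c}"
    "integral {0..c} (\<lambda>p. integral {p..c} (\<lambda>r. K p r))
      = integral {0..c} (\<lambda>r. integral {0..r} (\<lambda>p. K p r))"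
proof -
  define T where "T = {z :: real \<times> real. 0 \<le> fst z \<and> fst z \<le> snd z \<and> snd z \<le> c}"
  define F where "F = (\<lambda>p r. indicat_real T (p, r) *\<^sub>R K p r)"
  have "closed T" unfolding T_def
    by (intro closed_Collect_conj closed_Collect_le continuous_intros)
  moreover have "T \<subseteq> cbox (0, 0) (c, c)" by (auto simp: T_def)
  ultimately have "compact T" by (metis bounded_cbox bounded_subset compact_eq_bounded_closed)
  moreover have "continuous_on T (\<lambda>(x, y). K x y)" using assms continuous_on_subset by blast
  ultimately have "integrable lborel (\<lambda>z. indicator T z *\<^sub>R (case z of (x, y) \<Rightarrow> K x y))"
    by (rule borel_integrable_compact)
  hence int: "integrable (lborel \<Otimes>\<^sub>M lborel) (case_prod F)"
    by (simp add: F_def lborel_prod case_prod_unfold)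
  have K1: "continuous_on S (\<lambda>y. K x y)" "continuous_on S (\<lambda>y. K y x)" for S x
    by (rule continuous_on_compose2[OF assms, of _ "\<lambda>y.
      (x, y)", simplified], auto intro!: continuous_intros)
       (rule continuous_on_compose2[OF assms, of _ "\<lambda>y.
         (y, x)", simplified], auto intro!: continuous_intros)
  have si: "(LINT y : {a..b} | lborel. g y) = integral {a..b} g" if "continuous_on {a..b} g"
    for a b and g :: "real \<Rightarrow> real"
    using that by (intro set_borel_integral_eq_integral)
      (simp only: set_integrable_def, intro borel_integrable_compact, auto)
  have 1: "(\<integral>r. F p r \<partial>lborel) = indicator {0..c} p *\<^sub>R integral {p..c} (K p)" for p
  proof -
    have "(\<integral>r. F p r \<partial>lborel) = (\<integral>r. indicator {0..c} p *\<^sub>R (indicator {p..c} r *\<^sub>R K p r) \<partial>lborel)"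
      by (rule Bochner_Integration.integral_cong) (auto simp: F_def T_def indicator_def)
    thus ?thesis using si[OF K1(1), of p c] by (simp add: set_lebesgue_integral_def)
  qed
  have 2: "(\<integral>p. F p r \<partial>lborel) = indicator {0..c} r *\<^sub>R integral {0..r} (\<lambda>p. K p r)" for r
  proof -
    have "(\<integral>p. F p r \<partial>lborel) = (\<integral>p. indicator {0..c} r *\<^sub>R (indicator {0..r} p *\<^sub>R K p r) \<partial>lborel)"
      by (rule Bochner_Integration.integral_cong) (auto simp: F_def T_def indicator_def)
    thus ?thesis using si[OF K1(2), of 0 r] by (simp add: set_lebesgue_integral_def)
  qed
  have L0: "set_integrable lborel {0..c} (\<lambda>p. integral {p..c} (K p))"
    using lborel_pair.integrable_fst[OF int] unfolding 1 set_integrable_def .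
  from set_borel_integral_eq_integral(2)[OF L0]
  have L: "(\<integral>p. (\<integral>r. F p r \<partial>lborel) \<partial>lborel) = integral {0..c} (\<lambda>p. integral {p..c} (K p))"
    unfolding 1 set_lebesgue_integral_def .
  have R0: "set_integrable lborel {0..c} (\<lambda>r. integral {0..r} (\<lambda>p. K p r))"
    using lborel_pair.integrable_snd[OF int] unfolding 2 set_integrable_def .
  from set_borel_integral_eq_integral(2)[OF R0]
  have R: "(\<integral>r. (\<integral>p. F p r \<partial>lborel) \<partial>lborel) = integral {0..c} (\<lambda>r. integral {0..r} (\<lambda>p. K p r))"
    unfolding 2 set_lebesgue_integral_def .
  show "integral {0..c} (\<lambda>p. integral {p..c} (K p))
    = integral {0..c} (\<lambda>r. integral {0..r} (\<lambda>p. K p r))"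
    using lborel_pair.Fubini_integral[OF int] unfolding L R by simp
  show "(\<lambda>p. integral {p..c} (K p)) integrable_on {0..c}"
    "(\<lambda>r. integral {0..r} (\<lambda>p. K p r)) integrable_on {0..c}"
    using set_borel_integral_eq_integral(1)[OF L0] set_borel_integral_eq_integral(1)[OF R0] by auto
qed

lemma integral_reflect_about:
  fixes f :: "real \<Rightarrow> real"
  assumes "continuous_on {a..b} f" "a \<le> b"
  shows "integral {s - b..s - a} (\<lambda>x. f (s - x)) = integral {a..b} f"
proof -
  have "(f has_integral integral {a..b} f) (cbox a b)"
    using assms by (simp add: integrable_continuous_interval integrable_integral)
  from has_integral_affinity[OF this, of "-1" s]
  have "((\<lambda>x. f (s - x)) has_integral integral {a..b} f) ((\<lambda>x. s - x) ` {a..b})"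
    by (simp add: add.commute)
  also have "(\<lambda>x. s - x) ` {a..b} = {s - b..s - a}" using assms by simp
  finally show ?thesis by (rule integral_unique)
qed

lemma log_plus_walk_cont_slices:
  "continuous_on S (log_plus_walk p)" "continuous_on S (\<lambda>p. log_plus_walk p q)"
  by (auto intro!: continuous_intros)

lemma log_plus_walk_integral_cont: "continuous_on S (\<lambda>p. integral {a..b} (log_plus_walk p))"
proof -
  have "continuous_on UNIV (\<lambda>p. integral (cbox a b) (log_plus_walk p))"
    by (rule integral_continuous_on_param) (auto intro!: continuous_intros simp: case_prod_unfold)
  thus ?thesis using continuous_on_subset by auto
qed

text \<open>
  For \<open>p\<close> in \<open>[0, pi/2]\<close> the part of the region \<open>P > 1\<close>
  above \<open>q = p + pi/2\<close> is carried to the triangle \<open>p \<le> r \<le> pi/2\<close>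
  by the symmetry \<open>q = p + pi - r\<close> of \<open>P\<close>.
\<close>

lemma log_plus_walk_period_integral:
  assumes "0 \<le> p" "p \<le> pi/2"
  shows "integral {0..pi} (log_plus_walk p)
    = integral {0..pi/2} (log_plus_walk p) + integral {p..pi/2} (log_plus_walk p)"
proof -
  have io: "log_plus_walk p integrable_on {a..b}" for a b
    by (intro integrable_continuous_interval log_plus_walk_cont_slices)
  have "integral {0..pi} (log_plus_walk p)
    = integral {0..pi/2} (log_plus_walk p) + integral {pi/2..pi} (log_plus_walk p)"
    by (rule Henstock_Kurzweil_Integration.integral_combine[symmetric]) (auto intro!: io)
  also have "integral {pi/2..pi} (log_plus_walk p)
    = integral {pi/2..p + pi/2} (log_plus_walk p) + integral {p + pi/2..pi} (log_plus_walk p)"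
    by (rule Henstock_Kurzweil_Integration.integral_combine[symmetric])
      (use assms in \<open>auto intro!: io\<close>)
  \<comment> \<open>On this strip cos q <= 0 while the other two cosines are nonnegative, so P <=
    1.\<close>
  also have "integral {pi/2..p + pi/2} (log_plus_walk p) = integral {pi/2..p + pi/2} (\<lambda>q. 0)"
  proof (rule integral_cong)
    fix q assume q: "q \<in> {pi/2..p + pi/2}"
    have "0 \<le> cos p" using assms by (intro cos_ge_zero) auto
    moreover have "0 \<le> cos (p - q)" using assms q by (intro cos_ge_zero) auto
    moreover have "0 \<le> cos (q - pi)" using assms q by (intro cos_ge_zero) auto
    hence "cos q \<le> 0" by (simp add: cos_diff)
    ultimately have "8 * cos p * cos q * cos (p - q) \<le> 0"
      by (simp add: mult_nonneg_nonpos mult_nonpos_nonneg)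
    thus "log_plus_walk p q = 0" by (simp add: log_plus_walk_def walk_sq_def)
  qed
  also have "integral {p + pi/2..pi} (log_plus_walk p) = integral {p..pi/2} (log_plus_walk p)"
  proof -
    have "walk_sq p (p + pi - r) = walk_sq p r" for r
    proof -
      have "cos (p + pi - r) = - cos (p - r)" using cos_periodic_pi[of "p - r"]
        by (simp add: algebra_simps)
      moreover have "cos (p - (p + pi - r)) = - cos r" using cos_minus_pi[of r]
        by (simp add: algebra_simps cos_diff)
      ultimately show ?thesis by (simp add: walk_sq_def)
    qed
    hence "log_plus_walk p (p + pi - r) = log_plus_walk p r" for r by (simp add: log_plus_walk_def)
    moreover have "integral {p + pi - pi/2..p + pi - p} (\<lambda>x. log_plus_walk p (p + pi - x))
      = integral {p..pi/2} (log_plus_walk p)"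
      using assms by (intro integral_reflect_about log_plus_walk_cont_slices) auto
    ultimately show ?thesis by (simp add: field_simps)
  qed
  finally show ?thesis by simp
qed

lemma log_plus_walk_commute:
  "log_plus_walk p q = log_plus_walk q p" by (simp add: log_plus_walk_def walk_sq_commute)

lemma log_plus_walk_on_square: "log_plus_walk p q = ln (walk_sq p q)" if "(p, q) \<in> square"
  using walk_sq_bounds(1)[OF that] by (simp add: log_plus_walk_def max_def)

text \<open>The reflection of both variables at pi/2 reduces to p in [0, pi/2]. There each slice
  splits into the square and the triangle above the diagonal, which by symmetry carries half the
  square integral; in total 2(1 + 1/2) = 3 squares. Rescaling by pi divides by pi^2.\<close>

lemma log_plus_walk_torus_integral:
  "integral (cbox (0, 0) (1, 1)) (\<lambda>(a, b). log_plus_walk (pi * a) (pi * b)) = log_moment"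
proof -
  define c where "c = pi/2"
  have c: "c \<ge> 0" "pi - c = c" "c \<le> pi" by (auto simp: c_def)
  have io: "log_plus_walk p integrable_on {a..b}" for a b p
    by (intro integrable_continuous_interval log_plus_walk_cont_slices)
  define k where "k = (\<lambda>p. integral {0..pi} (log_plus_walk p))"
  have kc: "continuous_on S k" for S unfolding k_def by (rule log_plus_walk_integral_cont)
  have cont: "continuous_on S (\<lambda>(x, y). log_plus_walk x y)" for S
    by (auto intro!: continuous_intros simp: case_prod_unfold)
  have QH: "square_integral log_plus_walk = integral {0..c} (\<lambda>p. integral {0..c} (log_plus_walk p))"
    unfolding c_def by (rule square_integral_iterated) (rule cont)
  note ts = triangle_swap[of log_plus_walk c, OF cont]
  have tri: "integral {0..c} (\<lambda>p. integral {p..c} (log_plus_walk p))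
    = square_integral log_plus_walk / 2"
  proof -
    note QH
    also have "\<dots> = integral {0..c} (\<lambda>p. integral {0..p} (log_plus_walk p)
      + integral {p..c} (log_plus_walk p))"
      by (rule integral_cong, rule Henstock_Kurzweil_Integration.integral_combine[symmetric])
        (auto intro!: io)
    also have "\<dots> = integral {0..c} (\<lambda>p. integral {0..p} (log_plus_walk p))
      + integral {0..c} (\<lambda>p. integral {p..c} (log_plus_walk p))"
      by (rule integral_add) (use ts(1,2) in \<open>simp_all add: log_plus_walk_commute\<close>)
    also have "integral {0..c} (\<lambda>p. integral {0..p} (log_plus_walk p))
      = integral {0..c} (\<lambda>p. integral {p..c} (log_plus_walk p))"
      using ts(3) by (simp add: log_plus_walk_commute)
    finally show ?thesis by simp
  qed
  have sym: "k (pi - p) = k p" for p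
  proof -
    have "k (pi - p) = integral {pi - pi..pi - 0} (\<lambda>q. log_plus_walk (pi - p) (pi - q))"
      unfolding k_def by (rule integral_reflect_about[symmetric])
        (auto intro: log_plus_walk_cont_slices)
    also have "(\<lambda>q. log_plus_walk (pi - p) (pi - q)) = log_plus_walk p"
    proof
      fix q
      have "cos (q - p) = cos (p - q)" by (metis cos_minus minus_diff_eq)
      thus "log_plus_walk (pi - p) (pi - q) = log_plus_walk p q"
        by (simp add: log_plus_walk_def walk_sq_def)
    qed
    finally show ?thesis by (simp add: k_def)
  qed
  have "integral (cbox (0, 0) (pi, pi)) (\<lambda>(p, q). log_plus_walk p q) = integral {0..pi} k"
    using integral_prod_continuous[of 0 0 pi pi "\<lambda>(p, q). log_plus_walk p q"]
    by (simp add: k_def continuous_intros case_prod_unfold)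
  also have "\<dots> = integral {0..c} k + integral {c..pi} k"
    by (rule Henstock_Kurzweil_Integration.integral_combine[symmetric])
      (use c in \<open>auto intro!: integrable_continuous_interval kc\<close>)
  also have "integral {c..pi} k = integral {0..c} k"
    using integral_reflect_about[of 0 c k pi] c sym kc by simp
  also have "integral {0..c} k
    = integral {0..c} (\<lambda>p. integral {0..c} (log_plus_walk p) + integral {p..c} (log_plus_walk p))"
    by (rule integral_cong) (auto simp: k_def c_def log_plus_walk_period_integral)
  also have "\<dots> = integral {0..c} (\<lambda>p. integral {0..c} (log_plus_walk p))
    + integral {0..c} (\<lambda>p. integral {p..c} (log_plus_walk p))"
    by (intro integral_add ts(1) integrable_continuous_interval log_plus_walk_integral_cont)
  also have "\<dots> = square_integral log_plus_walk + square_integral log_plus_walk / 2"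
    unfolding QH[symmetric] tri ..
  finally have I: "integral (cbox (0, 0) (pi, pi)) (\<lambda>(p, q). log_plus_walk p q)
    = 3 * square_integral log_plus_walk" by simp
  have "((\<lambda>(p, q). log_plus_walk p q)
    has_integral 3 * square_integral log_plus_walk) (cbox (0, 0) (pi, pi))"
    unfolding I[symmetric] by (intro integrable_integral integrable_continuous)
      (auto intro!: continuous_intros simp: case_prod_unfold)
  from has_integral_affinity'[OF this, of pi 0]
  have "((\<lambda>(a, b). log_plus_walk (pi * a) (pi * b))
    has_integral 3 * square_integral log_plus_walk / pi\<^sup>2) (cbox (0, 0) (1, 1))"
    by (simp add: case_prod_unfold divide_inverse power2_eq_square mult_ac)
  moreover have "square_integral log_plus_walk = square_integral (\<lambda>p q. ln (walk_sq p q))"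
    unfolding square_integral_def by (rule integral_cong) (auto simp: log_plus_walk_on_square)
  ultimately show ?thesis by (simp add: log_moment_def integral_unique)
qed

subsection \<open>The Mahler measure by Jensen's formula\<close>

text \<open>Mean value property: Ln(1 + wz) is holomorphic on the closed unit disc, where Re(1 + wz)
  > 0, and vanishes at the centre. Cauchy's formula is applied there and the real part
  taken.\<close>

lemma jensen_inside:
  assumes "norm w < 1"
  shows "((\<lambda>s. ln (cmod (1 + w * cis (2 * pi * s)))) has_integral 0) {0..1}"
proof -
  define f where "f = (\<lambda>z. Ln (1 + w * z))"
  have re: "Re (1 + w * z) > 0" if "norm z \<le> 1" for z
  proof -
    have "norm (w * z) \<le> norm w * 1" unfolding norm_mult using that by (intro mult_left_mono) auto
    hence "norm (w * z) < 1" using assms by simp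
    thus ?thesis using abs_Re_le_cmod[of "w * z"] by simp
  qed
  have holo: "f holomorphic_on cball 0 1"
    unfolding f_def
  proof (intro holomorphic_intros)
    fix z assume "z \<in> cball (0::complex) 1"
    thus "1 + w * z \<notin> \<real>\<^sub>\<le>\<^sub>0" using re[of z] by (auto simp: complex_nonpos_Reals_iff)
  qed
  have "((\<lambda>u. f u / (u - 0)) has_contour_integral (2 * of_real pi * \<i> * f 0)) (circlepath 0 1)"
    by (rule Cauchy_integral_circlepath_simple[OF holo]) simp
  hence "((\<lambda>x. f (circlepath 0 1 x) / circlepath 0 1 x
    * vector_derivative (circlepath 0 1) (at x within {0..1})) has_integral 0) {0..1}"
    by (simp add: has_contour_integral_def f_def)
  hence "((\<lambda>x. 2 * of_real pi * \<i> * f (cis (2 * pi * x))) has_integral 0) {0..1}"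
  proof (rule has_integral_eq[rotated])
    fix x :: real assume "x \<in> {0..1}"
    hence v: "vector_derivative (circlepath 0 1) (at x within {0..1})
      = 2 * of_real pi * \<i> * cis (2 * pi * x)"
      using vector_derivative_circlepath01[of x 0 1] by (simp add: cis_conv_exp mult_ac)
    have c: "circlepath 0 1 x = cis (2 * pi * x)" by (simp add: circlepath cis_conv_exp mult_ac)
    show "f (circlepath 0 1 x) / circlepath 0 1 x
      * vector_derivative (circlepath 0 1) (at x within {0..1})
        = 2 * of_real pi * \<i> * f (cis (2 * pi * x))"
      unfolding v c by simp
  qed
  from has_integral_mult_right[OF this, of "1 / (2 * of_real pi * \<i>)"]
  have "((\<lambda>x. f (cis (2 * pi * x))) has_integral 0) {0..1}" by simp
  from has_integral_linear[OF this bounded_linear_Re]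
  have "((\<lambda>x. Re (f (cis (2 * pi * x)))) has_integral 0) {0..1}" by (simp add: o_def)
  thus ?thesis
  proof (rule has_integral_eq[rotated])
    fix x :: real
    have "1 + w * cis (2 * pi * x) \<noteq> 0" using re[of "cis (2 * pi * x)"]
      by (metis less_irrefl norm_cis order_refl zero_complex.sel(1))
    thus "Re (f (cis (2 * pi * x))) = ln (cmod (1 + w * cis (2 * pi * x)))" by (simp add: f_def)
  qed
qed

text \<open>For |w| < 1, conjugating and multiplying by the unit number z = cis t turns |w + z| into
  |1 + cnj(w) z|; for |w| > 1 the factor w is pulled out. Excluding |w| = 1 keeps the logarithmic
  singularity off the circle.\<close>

lemma jensen:
  assumes "norm w \<noteq> 1"
  shows "((\<lambda>s. ln (cmod (w + cis (2 * pi * s)))) has_integral ln (max 1 (cmod w))) {0..1}"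
proof (cases "norm w < 1")
  case True
  have "cmod (w + cis t) = cmod (1 + cnj w * cis t)" for t
  proof -
    have "cmod (w + cis t) = cmod (cnj (w + cis t))" by (rule complex_mod_cnj[symmetric])
    also have "\<dots> = cmod (cis t * cnj (w + cis t))" by (simp add: norm_mult)
    also have "cis t * cnj (w + cis t) = 1 + cnj w * cis t"
      by (simp add: algebra_simps cis_cnj cis_mult)
    finally show ?thesis .
  qed
  thus ?thesis using jensen_inside[of "cnj w"] True by (simp add: max_def)
next
  case False
  hence w: "norm w > 1" using assms by simp
  have n: "norm (inverse w) < 1" using w by (simp add: norm_inverse inverse_less_1_iff)
  have "((\<lambda>s. ln (cmod w)) has_integral ln (cmod w)) {0..1::real}"
    using has_integral_const_real[of "ln (cmod w)" 0 1] by simp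
  from has_integral_add[OF this jensen_inside[OF n]]
  have "((\<lambda>s. ln (cmod w) + ln (cmod (1 + inverse w * cis (2 * pi * s))))
    has_integral ln (cmod w)) {0..1}" by simp
  hence "((\<lambda>s. ln (cmod (w + cis (2 * pi * s)))) has_integral ln (cmod w)) {0..1}"
  proof (rule has_integral_eq[rotated])
    fix s :: real
    have "norm (inverse w * cis (2 * pi * s)) < 1" using n by (simp add: norm_mult)
    hence "1 + inverse w * cis (2 * pi * s) \<noteq> 0"
      by (metis add.commute add_eq_0_iff norm_minus_cancel norm_one less_irrefl)
    moreover have "w \<noteq> 0" using w by auto
    moreover from this have "w + cis (2 * pi * s) = w * (1 + inverse w * cis (2 * pi * s))"
      by (simp add: field_simps)
    hence "cmod (w + cis (2 * pi * s)) = cmod w * cmod (1 + inverse w * cis (2 * pi * s))"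
      by (simp only: norm_mult)
    ultimately show "ln (cmod w) + ln (cmod (1 + inverse w * cis (2 * pi * s)))
      = ln (cmod (w + cis (2 * pi * s)))"
      using ln_mult_pos[of "cmod w"] by simp
  qed
  thus ?thesis using w by (simp add: max_def)
qed

lemma cmod_eq_walk_sq:
  "cmod (1 + cis (2 * pi * a) + cis (2 * pi * b)) ^ 2 = walk_sq (pi * a) (pi * b)"
proof -
  define u v where "u = pi * a" and "v = pi * b"
  have e: "2 * pi * a = 2 * u" "2 * pi * b = 2 * v" by (auto simp: u_def v_def)
  have h: "(sin (2 * u))\<^sup>2 + (cos (2 * u))\<^sup>2 = 1" "(sin (2 * v))\<^sup>2 + (cos (2 * v))\<^sup>2 = 1" by auto
  have "cmod (1 + cis (2 * pi * a) + cis (2 * pi * b)) ^ 2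
      = (1 + cos (2 * u) + cos (2 * v))\<^sup>2 + (sin (2 * u) + sin (2 * v))\<^sup>2"
    unfolding e cmod_power2 by simp
  also have "\<dots> = walk_sq u v" unfolding walk_sq_alt cos_diff using h by algebra
  finally show ?thesis by (simp add: u_def v_def)
qed

lemma cmod_ne_1:
  assumes "a \<in> {0..1}" "b \<in> {0..1}" "a \<noteq> 1/2" "b \<notin> {1/2, a - 1/2, a + 1/2}"
  shows "cmod (1 + cis (2 * pi * a) + cis (2 * pi * b)) \<noteq> 1"
proof
  \<comment> \<open>A zero makes 2x an odd integer, and |2x| <= 2 leaves only 1 and -1.\<close>
  have c: "cos (pi * x) \<noteq> 0" if "\<bar>x\<bar> \<le> 1" "\<bar>x\<bar> \<noteq> 1/2" for x
  proof
    assume "cos (pi * x) = 0"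
    then obtain i :: int where i: "odd i" "pi * x = of_int i * (pi / 2)" unfolding cos_zero_iff_int
      by blast
    hence "2 * x = of_int i" by simp
    with that(1) have "\<bar>of_int i :: real\<bar> \<le> of_int 2" by simp
    hence "\<bar>i\<bar> \<le> 2" by linarith
    hence "i \<in> {-2..2}" by auto
    hence "i = -2 \<or> i = -1 \<or> i = 0 \<or> i = 1 \<or> i = 2" by auto
    with i(1) have "i = 1 \<or> i = -1" by auto
    thus False using that(2) \<open>2 * x = of_int i\<close> by auto
  qed
  assume "cmod (1 + cis (2 * pi * a) + cis (2 * pi * b)) = 1"
  hence "walk_sq (pi * a) (pi * b) = 1" using cmod_eq_walk_sq[of a b] by simp
  hence "cos (pi * a) = 0 \<or> cos (pi * b) = 0 \<or> cos (pi * (a - b)) = 0"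
    by (auto simp: walk_sq_def algebra_simps)
  moreover have "\<bar>a - b\<bar> \<le> 1" using assms by auto
  moreover have "\<bar>a - b\<bar> \<noteq> 1/2" using assms by (auto simp: abs_if split: if_splits)
  ultimately show False using c[of a] c[of b] c[of "a - b"] assms by auto
qed

text \<open>On the torus inverses are conjugates, so P3 = |w|^2 with w the sum of four unit numbers.
  As log |w| is unbounded below, Tonelli is applied to the nonnegative \<open>ln 4 - h\<close>,
  which gives integrability and the value together; the inner integral is Jensen's.\<close>

lemma mahler3_P3:
  "mahler3 P3 = integral (cbox (0, 0) (1, 1)) (\<lambda>(a, b). ln (max 1 (walk_sq (pi * a) (pi
    * b))))" (is "_ = ?I")
proof -
  define A where "A = ({0..1} \<times> {0..1} \<times> {0..1} :: (real \<times> real \<times> real) set)"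
  define W where "W = (\<lambda>a b. 1 + cis (2 * pi * a) + cis (2 * pi * b))"
  define h where "h = (\<lambda>s :: real \<times> real \<times> real. ln (cmod (W (fst s) (fst (snd s))
    + cis (2 * pi * snd (snd s)))))"
  have P3: "ln (cmod (P3 (cis (2 * pi * fst s)) (cis (2 * pi * fst (snd s))) (cis (2 * pi
    * snd (snd s))))) = 2 * h s" for s
  proof -
    define w where "w = W (fst s) (fst (snd s)) + cis (2 * pi * snd (snd s))"
    have "P3 (cis (2 * pi * fst s)) (cis (2 * pi * fst (snd s))) (cis (2 * pi * snd (snd s)))
      = w * cnj w"
      by (simp add: P3_def w_def W_def cis_cnj)
    thus ?thesis by (simp add: h_def w_def[symmetric] norm_mult ln_mult)
  qed
  \<comment> \<open>|w| <= 4 makes k nonnegative; at w = 0 this rests on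
    \<open>ln 0 = 0\<close>.\<close>
  define k where "k = (\<lambda>s. ln 4 - h s)"
  have k0: "k s \<ge> 0" for s
  proof -
    define w where "w = W (fst s) (fst (snd s)) + cis (2 * pi * snd (snd s))"
    have "cmod w \<le> 1 + 1 + 1 + 1" unfolding w_def W_def
      by (intro order.trans[OF norm_triangle_ineq] add_mono) auto
    hence "w \<noteq> 0 \<Longrightarrow> ln (cmod w) \<le> ln 4" by (subst ln_le_cancel_iff) auto
    thus ?thesis by (cases "w = 0") (auto simp: k_def h_def w_def[symmetric])
  qed
  have meas: "h \<in> borel_measurable borel"
  proof -
    have "(\<lambda>s :: real \<times> real \<times> real. cmod (W (fst s) (fst (snd s))
      + cis (2 * pi * snd (snd s)))) \<in> borel_measurable borel"
      unfolding W_def by (intro borel_measurable_continuous_onI continuous_intros)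
    thus ?thesis unfolding h_def by measurable
  qed
  have A: "A \<in> sets borel" unfolding A_def by (intro borel_closed closed_Times closed_atLeastAtMost)
  define g where "g = (\<lambda>s. ennreal (indicator A s * k s))"
  have gm: "g \<in> borel_measurable borel" unfolding g_def k_def using meas A by measurable
  define L where "L = (\<lambda>a b. ln (max 1 (cmod (W a b))))"
  have inner: "(\<integral>\<^sup>+c. g (a, b, c) \<partial>lborel)
    = ennreal (indicator {0..1} a * indicator {0..1} b * (ln 4 - L a b))"
    if "a \<noteq> 1/2" "b \<notin> {1/2, a - 1/2, a + 1/2}" for a b
  proof (cases "a \<in> {0..1} \<and> b \<in> {0..1}")
    case True
    with that have "cmod (W a b) \<noteq> 1" unfolding W_def by (intro cmod_ne_1) auto
    from jensen[OF this] have "((\<lambda>c. h (a, b, c)) has_integral L a b) {0..1}"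
      by (simp add: h_def L_def)
    moreover have "((\<lambda>c. ln 4) has_integral ln 4) {0..1::real}"
      using has_integral_const_real[of "ln 4" 0 1] by simp
    ultimately have "((\<lambda>c. k (a, b, c)) has_integral ln 4 - L a b) {0..1}"
      unfolding k_def by (intro has_integral_diff) auto
    from nn_integral_has_integral_lebesgue[OF _ this] k0
    have "(\<integral>\<^sup>+c. ennreal (indicator {0..1} c * k (a, b, c)) \<partial>lborel) = ennreal (ln 4 - L a b)"
      by auto
    moreover have "g (a, b, c) = ennreal (indicator {0..1} c * k (a, b, c))" for c
      using True by (auto simp: g_def A_def indicator_def)
    ultimately show ?thesis using True by simp
  next
    case False
    hence "g (a, b, c) = 0" for c by (auto simp: g_def A_def indicator_def)
    thus ?thesis using False by (auto simp: indicator_def)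
  qed
  define S where "S = cbox (0, 0) (1 :: real, 1 :: real)"
  have S4: "((\<lambda>z. ln (4 :: real)) has_integral ln 4) S"
    unfolding S_def using has_integral_const[of "ln 4 :: real" "(0, 0)" "(1 :: real, 1 :: real)"]
      by (simp add: content_Pair)
  have Lc: "continuous_on UNIV (\<lambda>z. L (fst z) (snd z))"
    unfolding L_def W_def by (intro continuous_intros) auto
  have L4: "L a b \<le> ln 4" for a b
  proof -
    have "cmod (W a b) \<le> 1 + 1 + 1" unfolding W_def
      by (intro order.trans[OF norm_triangle_ineq] add_mono) auto
    thus ?thesis unfolding L_def by (subst ln_le_cancel_iff) auto
  qed
  \<comment> \<open>P = |W|^2 makes L half of \<open>ln (max 1 P)\<close>; the factor 2 from P3 =
    |w|^2 restores \<open>?I\<close> at the end.\<close>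
  have LI: "((\<lambda>z. L (fst z) (snd z)) has_integral ?I / 2) S"
  proof -
    have WP: "walk_sq (pi * a) (pi * b) = cmod (W a b) ^ 2" for a b using cmod_eq_walk_sq[of a b]
      by (simp add: W_def)
    have "2 * L a b = ln (max 1 (walk_sq (pi * a) (pi * b)))" for a b
    proof -
      have "max 1 (cmod (W a b)) ^ 2 = max 1 (walk_sq (pi * a) (pi * b))"
        unfolding WP using power_le_one[of "cmod (W a b)" 2] one_le_power[of "cmod (W a b)" 2]
        by (cases "cmod (W a b) \<le> 1") (simp_all add: max_absorb1 max_absorb2)
      moreover have "ln (max 1 (cmod (W a b)) ^ 2) = 2 * L a b" unfolding L_def
        by (subst ln_realpow) auto
      ultimately show ?thesis by simp
    qed
    hence e: "(case z of (a, b) \<Rightarrow> ln (max 1 (walk_sq (pi * a) (pi * b)))) = 2 * L (fst z) (snd z)"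
      for z
      by (simp add: case_prod_unfold)
    have "(\<lambda>z. L (fst z) (snd z)) integrable_on S"
      unfolding S_def by (intro integrable_continuous continuous_on_subset[OF Lc]) auto
    thus ?thesis unfolding e S_def[symmetric] by (simp add: integrable_integral)
  qed
  have "(\<integral>\<^sup>+s. g s \<partial>lborel) = (\<integral>\<^sup>+s. g s \<partial>(lborel \<Otimes>\<^sub>M (lborel \<Otimes>\<^sub>M lborel)))"
    by (simp add: lborel_prod)
  also have "\<dots> = (\<integral>\<^sup>+a. (\<integral>\<^sup>+z. g (a, z) \<partial>(lborel \<Otimes>\<^sub>M lborel)) \<partial>lborel)"
    using gm lborel.nn_integral_fst[of g lborel] by (simp add: lborel_prod)
  also have "\<dots> = (\<integral>\<^sup>+a. (\<integral>\<^sup>+b. (\<integral>\<^sup>+c. g (a, b, c) \<partial>lborel) \<partial>lborel) \<partial>lborel)"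
  proof (rule nn_integral_cong)
    fix a
    have "(\<lambda>z. g (a, z)) \<in> borel_measurable borel"
      by (rule measurable_compose[OF _ gm])
        (intro borel_measurable_continuous_onI continuous_intros)
    thus "(\<integral>\<^sup>+z. g (a, z) \<partial>(lborel \<Otimes>\<^sub>M lborel)) = (\<integral>\<^sup>+b. (\<integral>\<^sup>+c. g (a, b, c) \<partial>lborel) \<partial>lborel)"
      using lborel.nn_integral_fst[of "\<lambda>z. g (a, z)" lborel] by (simp add: lborel_prod)
  qed
  \<comment> \<open>\<open>inner\<close> fails to apply only at a = 1/2 and, for each other a, at
    three values of b; these are null sets.\<close>
  also have "\<dots> = (\<integral>\<^sup>+a. (\<integral>\<^sup>+b. ennreal (indicator S (a, b) * (ln 4 - L a b)) \<partial>lborel) \<partial>lborel)"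
  proof (rule nn_integral_cong_AE)
    have "AE a in lborel. a \<notin> {1/2 :: real}" by (intro AE_not_in finite_imp_null_set_lborel) auto
    thus "AE a in lborel. (\<integral>\<^sup>+b. (\<integral>\<^sup>+c. g (a, b, c) \<partial>lborel) \<partial>lborel)
      = (\<integral>\<^sup>+b. ennreal (indicator S (a, b) * (ln 4 - L a b)) \<partial>lborel)"
    proof eventually_elim
      case (elim a)
      have "AE b in lborel. b \<notin> {1/2, a - 1/2, a + 1/2}"
        by (intro AE_not_in finite_imp_null_set_lborel) auto
      hence "AE b in lborel. (\<integral>\<^sup>+c. g (a, b, c) \<partial>lborel)
        = ennreal (indicator S (a, b) * (ln 4 - L a b))"
      proof eventually_elim
        case (elim b)
        have "indicator {0..1} a * indicator {0..1} b = indicat_real S (a, b)"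
          by (auto simp: S_def indicator_def)
        thus ?case using inner[OF _ elim] \<open>a \<notin> {1/2}\<close> by simp
      qed
      thus ?case by (rule nn_integral_cong_AE)
    qed
  qed
  also have "\<dots> = (\<integral>\<^sup>+z. ennreal (indicator S z * (ln 4 - L (fst z) (snd z))) \<partial>(lborel \<Otimes>\<^sub>M lborel))"
  proof -
    have "(\<lambda>z. L (fst z) (snd z)) \<in> borel_measurable borel"
      by (rule borel_measurable_continuous_onI[OF Lc])
    hence "(\<lambda>z. ennreal (indicator S z * (ln 4 - L (fst z) (snd z)))) \<in> borel_measurable borel"
      unfolding S_def by measurable
    thus ?thesis
      using lborel.nn_integral_fst[of "\<lambda>z. ennreal (indicator S z * (ln 4
        - L (fst z) (snd z)))" lborel]
      by (simp add: lborel_prod)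
  qed
  also have "\<dots> = ennreal (ln 4 - ?I / 2)"
  proof -
    from has_integral_diff[OF S4 LI] show ?thesis
      unfolding lborel_prod by (intro nn_integral_has_integral_lebesgue) (use L4 in auto)
  qed
  finally have N: "(\<integral>\<^sup>+s. ennreal (indicator A s * k s) \<partial>lborel) = ennreal (ln 4 - ?I / 2)"
    unfolding g_def .
  \<comment> \<open>\<open>ennreal\<close> sends negative reals to 0, so N yields a real integral
    only once ln 4 - \<open>?I / 2\<close> is known to be nonnegative.\<close>
  have "?I / 2 \<le> ln 4 * 1"
  proof -
    from has_integral_le[OF LI S4] show ?thesis using L4 by simp
  qed
  hence K: "has_bochner_integral lborel (\<lambda>s. indicator A s * k s) (ln 4 - ?I / 2)"
    using meas A k0 N unfolding k_def
    by (intro has_bochner_integral_nn_integral) auto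
  have C: "has_bochner_integral lborel (\<lambda>s. indicator A s * ln (4 :: real)) (ln 4)"
  proof -
    have A_box: "A = cbox (0,0,0) (1,1,1)" by (auto simp: A_def)
    have "measure lborel A = 1" unfolding A_box by (simp add: content_Pair)
    moreover have "emeasure lborel A < \<infinity>" unfolding A_box by (rule emeasure_lborel_cbox_finite)
    ultimately show ?thesis
      using has_bochner_integral_mult_left[OF has_bochner_integral_real_indicator[of A lborel], of
        "ln 4"] A by simp
  qed
  \<comment> \<open>The cube has volume 1, so subtracting k from the constant ln 4 recovers the
    integral of h.\<close>
  from has_bochner_integral_diff[OF C K]
  have "has_bochner_integral lborel (\<lambda>s. indicator A s * h s) (?I / 2)"
    by (simp add: k_def algebra_simps)
  from has_bochner_integral_mult_right[OF this, of 2]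
  have "has_bochner_integral lborel (\<lambda>s. indicator A s *\<^sub>R (2 * h s)) ?I" by (simp add: mult_ac)
  thus ?thesis unfolding mahler3_def set_lebesgue_integral_def P3 A_def[symmetric]
    by (rule has_bochner_integral_integral_eq)
qed

subsection \<open>The theorem\<close>

text \<open>F is the power series part of the inverse theta, continued to a domain containing the
  negative axis. The logarithmic part b(0) log t is written with \<open>Ln\<close>, as the branch
  does not affect the real part.\<close>

theorem theorem4p2:
  fixes phi psi :: "complex \<Rightarrow> complex" and r :: real
  assumes "r > 0"
    and "phi holomorphic_on ball 0 r" and "psi holomorphic_on ball 0 r"
    and "\<forall>t\<in>ball 0 r. L2 phi t = 0"
    and "\<forall>t\<in>ball 0 r. L2 psi t = t / (1 - t)"
    and "phi 0 = 1" and "deriv phi 0 = 3"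
    and "psi 0 = 0" and "deriv psi 0 = 1"
  shows "\<exists>U F. open U \<and> connected U \<and> ball 0 r \<subseteq> U \<and> of_real ` {..0} \<subseteq> U
     \<and> F holomorphic_on U
     \<and> (\<forall>t\<in>ball 0 r. F t = inv_theta_series (\<lambda>t. 3/4 * phi t + 6 / pi^2 * psi t) t)
     \<and> ((\<lambda>x::real. - Re ((3/4 * phi 0 + 6 / pi^2 * psi 0) * Ln (of_real x) + F (of_real x)))
          \<longlongrightarrow> mahler3 P3) at_bot"
proof -
  have M: "mahler3 P3 = log_moment"
    using mahler3_P3 log_plus_walk_torus_integral unfolding log_plus_walk_def by simp
  define b where "b = (\<lambda>t. 3/4 * phi t + 6 / pi^2 * psi t)"
  have cf: "(deriv ^^ n) b 0 / fact n = of_real (moment n)" for n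
    unfolding b_def by (rule taylor_coeffs_eq_moment) (use assms in auto)
  have bh: "b holomorphic_on ball 0 r"
    unfolding b_def using assms by (intro holomorphic_intros) auto
  define I where "I = inv_theta_series b"
  have I_alt: "I t = (\<Sum>m. of_real (moment (Suc m)) / of_nat (Suc m) * t ^ Suc m)" for t
    unfolding I_def inv_theta_series_def divide_divide_eq_left[symmetric] cf ..
  \<comment> \<open>The Taylor series of b converges absolutely in the whole ball, by comparison
    with a radius x between |t| and r; dividing the coefficients by n preserves this.\<close>
  have I_sums: "(\<lambda>n. of_real (moment n) / of_nat n * t ^ n) sums I t" if t: "t \<in> ball 0 r" for t
  proof -
    obtain x where x: "norm t < x" "x < r" "0 \<le> x" using t dense[of "norm t" r]
      by (auto intro: order_trans[OF norm_ge_zero less_imp_le])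
    have "summable (\<lambda>n. of_real (moment n) * (of_real x :: complex) ^ n)"
      using holomorphic_power_series[OF bh, of "of_real x"] x unfolding cf sums_iff by simp
    hence "summable (\<lambda>n. norm (of_real (moment n) * t ^ n))"
      by (rule powser_insidea) (use x in auto)
    hence "summable (\<lambda>n. of_real (moment n) / of_nat n * t ^ n)"
    proof (rule summable_comparison_test'[where N = 1])
      fix n :: nat assume "n \<ge> 1"
      hence "norm (of_real (moment n) * t ^ n) / real n \<le> norm (of_real (moment n) * t ^ n) / 1"
        by (intro divide_left_mono) auto
      thus "norm (of_real (moment n) / of_nat n * t ^ n) \<le> norm (of_real (moment n) * t ^ n)"
        by (simp add: norm_mult norm_divide)
    qed
    hence s: "(\<lambda>n. of_real (moment n) / of_nat n * t ^ n) sums (\<Sum>n. of_real (moment n) / of_nat n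
      * t ^ n)"
      by (rule summable_sums)
    \<comment> \<open>The index shift loses nothing: the term at n = 0 is a division by 0, hence
      0.\<close>
    hence "(\<lambda>m. of_real (moment (Suc m)) / of_nat (Suc m)
      * t ^ Suc m) sums (\<Sum>n. of_real (moment n) / of_nat n * t ^ n)"
      by (subst sums_Suc_iff) simp
    thus ?thesis using s unfolding I_alt by (simp add: sums_iff)
  qed
  have Ih: "I holomorphic_on ball 0 r"
    by (rule power_series_holomorphic[where a
      = "\<lambda>n. of_real (moment n) / of_nat n"]) (use I_sums in auto)
  have eq0: "log_potential t = I t" if "norm t < 1/9" "t \<in> ball 0 r" for t
    using log_potential_sums[OF that(1)] I_sums[OF that(2)] sums_unique2 by blast
  \<comment> \<open>The series identity is known only for |t| < 1/9, while r is arbitrary. The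
    identity theorem extends it over the star-shaped intersection of the two domains.\<close>
  have eq: "log_potential t = I t" if "t \<in> slit_plane" "t \<in> ball 0 r" for t
  proof (rule analytic_continuation_open[of "ball 0 (min r (1/9))"
    "slit_plane \<inter> ball 0 r" log_potential I t])
    show "open (slit_plane \<inter> ball 0 r)" using open_slit_plane by blast
    show "ball 0 (min r (1/9)) \<noteq> ({} :: complex set)" using assms(1) by simp
    show "connected (slit_plane \<inter> ball 0 r)"
    proof (intro starlike_imp_connected)
      have "closed_segment 0 y \<subseteq> slit_plane \<inter> ball 0 r" if "y \<in> slit_plane \<inter> ball 0 r" for y
      proof -
        have "closed_segment 0 y \<subseteq> ball 0 r"
          using that assms(1) by (intro closed_segment_subset) auto
        moreover have "closed_segment 0 y \<subseteq> slit_plane"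
          using that slit_plane_scale[of y] by (auto simp: closed_segment_def scaleR_conv_of_real)
        ultimately show ?thesis by blast
      qed
      moreover have "0 \<in> slit_plane \<inter> ball 0 r" using assms(1) by (auto simp: slit_plane_def)
      ultimately show "starlike (slit_plane \<inter> ball 0 r)" unfolding starlike_def by blast
    qed
    show "ball 0 (min r (1/9)) \<subseteq> slit_plane \<inter> ball 0 r"
    proof
      fix t :: complex assume t: "t \<in> ball 0 (min r (1/9))"
      thus "t \<in> slit_plane \<inter> ball 0 r" using complex_Re_le_cmod[of t] by (auto simp: slit_plane_def)
    qed
    show "log_potential holomorphic_on slit_plane \<inter> ball 0 r"
      "I holomorphic_on slit_plane \<inter> ball 0 r"
      using log_potential_holomorphic Ih by (auto intro: holomorphic_on_subset)
    show "t \<in> slit_plane \<inter> ball 0 r" using that by blast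
  qed (use eq0 in auto)
  \<comment> \<open>If r > 1/9, the ball meets the ray removed from \<open>slit_plane\<close>; hence
    the series is used on the ball and the integral outside.\<close>
  define F where "F = (\<lambda>t. if t \<in> ball 0 r then I t else log_potential t)"
  have F_slit: "F t = log_potential t" if "t \<in> slit_plane" for t using eq that by (auto simp: F_def)
  show ?thesis
  proof (intro exI[of _ "ball 0 r \<union> slit_plane"] exI[of _ F] conjI ballI)
    show "open (ball 0 r \<union> slit_plane)" using open_slit_plane by blast
    have "connected slit_plane"
    proof (intro starlike_imp_connected)
      have "closed_segment 0 y \<subseteq> slit_plane" if "y \<in> slit_plane" for y
        using that slit_plane_scale[of y] by (auto simp: closed_segment_def scaleR_conv_of_real)
      moreover have "0 \<in> slit_plane" by (simp add: slit_plane_def)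
      ultimately show "starlike slit_plane" unfolding starlike_def by blast
    qed
    moreover have "0 \<in> ball 0 r" "0 \<in> slit_plane" using assms(1) by (simp_all add: slit_plane_def)
    ultimately show "connected (ball 0 r \<union> slit_plane)"
      by (intro connected_Un connected_ball) blast+
    show "F holomorphic_on ball 0 r \<union> slit_plane"
      unfolding F_def by (rule holomorphic_on_If_Un)
        (use Ih log_potential_holomorphic open_slit_plane eq in auto)
    show "F t = inv_theta_series (\<lambda>t. 3/4 * phi t + 6 / pi^2 * psi t) t" if "t \<in> ball 0 r" for t
      using that by (simp add: F_def I_def b_def)
    show "of_real ` {..0} \<subseteq> ball 0 r \<union> slit_plane" by (auto simp: slit_plane_def)
    show "((\<lambda>x::real. - Re ((3/4 * phi 0 + 6 / pi^2 * psi 0) * Ln (of_real x)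
      + F (of_real x))) \<longlongrightarrow> mahler3 P3) at_bot"
      unfolding M
    proof (rule Lim_transform_eventually[OF log_potential_limit])
      show "eventually (\<lambda>x. 3 / pi\<^sup>2 * square_integral (\<lambda>p q. ln (walk_sq p q + inverse (-x))) =
          - Re ((3/4 * phi 0 + 6 / pi^2 * psi 0) * Ln (of_real x) + F (of_real x))) at_bot"
        using eventually_gt_at_bot[of 0]
      proof eventually_elim
        case (elim x)
        \<comment> \<open>The coefficient of \<open>Ln\<close> is 3/4, a real number, so the
          imaginary part pi drops out of the real part.\<close>
        have "Ln (of_real x) = of_real (ln (-x)) + \<i> * pi"
          using Ln_minus[of "of_real (-x)"] elim by (auto simp: Ln_of_real simp flip: of_real_minus)
        hence "Re ((3/4 * phi 0 + 6 / pi^2 * psi 0) * Ln (of_real x)) = 3/4 * ln (-x)"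
          using assms by (simp add: Re_divide_numeral)
        moreover have "F (of_real x) = log_potential (of_real x)"
          using elim by (intro F_slit) (simp add: slit_plane_def)
        ultimately show ?case using log_potential_negative_real[OF elim] by simp
      qed
    qed
  qed (use assms in auto)
qed

end
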